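(* Let $m\in\mathbb{N}$, let $h:\mathbb{N}^m\to\mathbb{N}$ be a polynomial having no constant term, and let $A\subseteq\mathbb{N}$. The following statements are equivalent. (1) There exist functions $\alpha_1,\ldots,\alpha_m:\mathcal{P}_f(\mathbb{N}^{\mathbb{N}})\to\mathbb{N}$ and $H_1,\ldots,H_m:\mathcal{P}_f(\mathbb{N}^{\mathbb{N}})\to\mathcal{P}_f(\mathbb{N})$ such that (a) if $F,G\in\mathcal{P}_f(\mathbb{N}^{\mathbb{N}})$ and $F\subsetneq G$, then for each $i\in\{1,\ldots,m\}$, $\max H_i(F)<\min H_i(G)$; and (b) whenever $(G_i)_{i\in\mathbb{N}}$ is a sequence in $\mathcal{P}_f(\mathbb{N}^{\mathbb{N}})$ with $G_1\subsetneq G_2\subsetneq\cdots\subsetneq G_n\subsetneq\cdots$, then for all $\beta_1<\cdots<\beta_m$ in $\mathcal{P}_f(\mathbb{N})$ and all choices of $f_i\in G_i$ ($i\in\mathbb{N}$), one has $$h\left(\sum_{i\in\beta_1}\Bigl(\alpha_1(G_i)+\sum_{t\in H_1(G_i)}f_i(t)\Bigr),\ldots,\sum_{i\in\beta_m}\Bigl(\alpha_m(G_i)+\sum_{t\in H_m(G_i)}f_i(t)\Bigr)\right)\in A.$$ (2) There exist idempotents $p_1,\ldots,p_m$ in $(\mathcal{J},+)$ such that $A\in\tilde h\left(\bigotimes_{i=1}^m p_i\right)$.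
   Context: $\mathbb{N}$ is the set of positive integers; $\mathcal{P}_f(X)$ is the set of nonempty finite subsets of $X$; $\mathbb{N}^{\mathbb{N}}$ is the set of all functions $\mathbb{N}\to\mathbb{N}$. For $\beta,\gamma\in\mathcal{P}_f(\mathbb{N})$, $\beta<\gamma$ means $\max\beta<\min\gamma$. $\beta X$ denotes the set of ultrafilters on a discrete set $X$ (Stone–Čech compactification). On $\beta\mathbb{N}$: $A\in p+q$ iff $\{x\in\mathbb{N}:-x+A\in q\}\in p$, where $-x+A=\{y\in\mathbb{N}:x+y\in A\}$. An ultrafilter $p$ is idempotent if $p+p=p$. For a map $h:\mathbb{N}^m\to\mathbb{N}$, $\tilde h:\beta(\mathbb{N}^m)\to\beta\mathbb{N}$ is its continuous extension: $A\in\tilde h(u)$ iff $h^{-1}(A)\in u$. A set $A\subseteq\mathbb{N}$ is a $J$-set if for every $F\in\mathcal{P}_f(\mathbb{N}^{\mathbb{N}})$ there exist $a\in\mathbb{N}$ and $\beta\in\mathcal{P}_f(\mathbb{N})$ such that $a+\sum_{t\in\beta}f(t)\in A$ for all $f\in F$. $\mathcal{J}=\{p\in\beta\mathbb{N}:\text{every }A\in p\text{ is a }J\text{-set}\}$; it is a two-sided ideal of $(\beta\mathbb{N},+)$. Tensor products: for ultrafilters $p_1,\ldots,p_k$ on $\mathbb{N}$, $\bigotimes_{i=1}^k p_i$ is the ultrafilter on $\mathbb{N}^k$ defined recursively by $\bigotimes_{i=1}^1p_i=p_1$, and, for $A\subseteq\mathbb{N}^{k+1}$, $A\in\bigotimes_{i=1}^{k+1}p_i$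 iff $\{(x_1,\ldots,x_k)\in\mathbb{N}^k:\{x_{k+1}\in\mathbb{N}:(x_1,\ldots,x_{k+1})\in A\}\in p_{k+1}\}\in\bigotimes_{i=1}^kp_i$. *)

theory Defs
  imports "HOL-Library.FuncSet" "HOL-Library.Poly_Mapping" Complex_Main
begin

text \<open>
  The positive integers are treated as a carrier set inside \<^typ>\<open>nat\<close>. Functions between carriers
  are extensional (\<^const>\<open>PiE\<close>) wherever they are collected into sets, so that two functions are
  equal exactly when they agree on the carrier.
\<close>

definition PN :: "nat set" where
  "PN = {n. 0 < n}"

definition Pf :: "'a set \<Rightarrow> 'a set set" where
  "Pf X = Fpow X - {{}}"

definition PNPN :: "(nat \<Rightarrow> nat) set" where
  "PNPN = PN \<rightarrow>\<^sub>E PN"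

definition PNpow :: "nat \<Rightarrow> (nat \<Rightarrow> nat) set" where
  "PNpow m = {1..m} \<rightarrow>\<^sub>E PN"

definition ultrafilter_on :: "'a set \<Rightarrow> 'a set set \<Rightarrow> bool" where
  "ultrafilter_on X u \<longleftrightarrow>
     u \<subseteq> Pow X \<and> X \<in> u \<and> {} \<notin> u \<and>
     (\<forall>A\<in>u. \<forall>B\<in>u. A \<inter> B \<in> u) \<and>
     (\<forall>A\<in>u. \<forall>B. A \<subseteq> B \<and> B \<subseteq> X \<longrightarrow> B \<in> u) \<and>
     (\<forall>A. A \<subseteq> X \<longrightarrow> A \<in> u \<or> X - A \<in> u)"

definition beta :: "'a set \<Rightarrow> 'a set set set" where
  "beta X = {u. ultrafilter_on X u}"

definition uf_plus :: "nat set set \<Rightarrow> nat set set \<Rightarrow> nat set set" where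
  "uf_plus p q = {A. A \<subseteq> PN \<and> {x \<in> PN. {y \<in> PN. x + y \<in> A} \<in> q} \<in> p}"

definition uf_idempotent :: "nat set set \<Rightarrow> bool" where
  "uf_idempotent p \<longleftrightarrow> uf_plus p p = p"

definition uf_ext :: "nat \<Rightarrow> ((nat \<Rightarrow> nat) \<Rightarrow> nat) \<Rightarrow> (nat \<Rightarrow> nat) set set \<Rightarrow> nat set set" where
  "uf_ext m h u = {A. A \<subseteq> PN \<and> {x \<in> PNpow m. h x \<in> A} \<in> u}"

definition J_set :: "nat set \<Rightarrow> bool" where
  "J_set A \<longleftrightarrow> A \<subseteq> PN \<and>
     (\<forall>F \<in> Pf PNPN. \<exists>a \<in> PN. \<exists>b \<in> Pf PN. \<forall>f \<in> F. a + (\<Sum>t\<in>b. f t) \<in> A)"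

definition JJ :: "nat set set set" where
  "JJ = {p \<in> beta PN. \<forall>A \<in> p. J_set A}"

text \<open>
  \<open>tensor p k\<close> is the tensor product of \<open>p 1, \<dots>, p k\<close>. A number \<open>x\<close> is identified with the
  one-element tuple \<open>\<lambda>i\<in>{1}. x\<close>, and \<open>x(Suc k := y)\<close> appends \<open>y\<close> to a \<open>k\<close>-tuple \<open>x\<close>.
  The value at \<open>0\<close> is a dummy.
\<close>
fun tensor :: "(nat \<Rightarrow> nat set set) \<Rightarrow> nat \<Rightarrow> (nat \<Rightarrow> nat) set set" where
  "tensor p 0 = {}"
| "tensor p (Suc 0) = {A. A \<subseteq> PNpow 1 \<and> {x \<in> PN. (\<lambda>i\<in>{1}. x) \<in> A} \<in> p 1}"
| "tensor p (Suc (Suc k)) =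
     {A. A \<subseteq> PNpow (Suc (Suc k)) \<and>
         {x \<in> PNpow (Suc k). {y \<in> PN. x(Suc (Suc k) := y) \<in> A} \<in> p (Suc (Suc k))}
           \<in> tensor p (Suc k)}"

text \<open>
  A polynomial is a finitely supported map from monomials (finitely supported exponent vectors) to
  coefficients. Coefficients are real so that every integer-valued polynomial is covered, for
  instance \<open>x (x + 1) / 2\<close>.
\<close>
definition poly_eval :: "((nat \<Rightarrow>\<^sub>0 nat) \<Rightarrow>\<^sub>0 real) \<Rightarrow> (nat \<Rightarrow> nat) \<Rightarrow> real" where
  "poly_eval P x =
     (\<Sum>e\<in>Poly_Mapping.keys P.
        Poly_Mapping.lookup P e *
        (\<Prod>i\<in>Poly_Mapping.keys e. real (x i) ^ Poly_Mapping.lookup e i))"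

definition poly_no_const :: "nat \<Rightarrow> ((nat \<Rightarrow> nat) \<Rightarrow> nat) \<Rightarrow> bool" where
  "poly_no_const m h \<longleftrightarrow>
     h \<in> PNpow m \<rightarrow> PN \<and>
     (\<exists>P. (\<forall>e \<in> Poly_Mapping.keys P. Poly_Mapping.keys e \<subseteq> {1..m}) \<and>
          Poly_Mapping.lookup P 0 = 0 \<and>
          (\<forall>x \<in> PNpow m. real (h x) = poly_eval P x))"

end

theory Submission
  imports Defs
begin

text \<open>
  Condition (1) says that the tuples obtained from a strictly increasing chain of finite sets of
  functions, cut into \<open>m\<close> consecutive blocks, all lie in \<open>B = h -` A\<close>.

  From (1) to (2): for fixed \<open>j\<close> let \<open>T\<^sub>j F\<close> be the set of sums along chains lying strictly above
  \<open>F\<close>. The ultrafilters containing all \<open>T\<^sub>j F\<close> form a closed semigroup, which meets \<open>J\<close> because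
  a finite cover of \<open>T\<^sub>j F\<close> always has a J-set among its members: code chain sums by words over
  a finite alphabet of functions and apply the infinite Hales-Jewett theorem. An idempotent \<open>p\<^sub>j\<close>
  in the intersection works, since appending a chain above the last set used so far stays in \<open>B\<close>.

  From (2) to (1): choose \<open>\<alpha>\<^sub>j F\<close> and \<open>H\<^sub>j F\<close> simultaneously for all \<open>j\<close> by recursion on the finite set
  \<open>F\<close>. Only finitely many partial tuples arise from chains below \<open>F\<close>, and each of them forbids only
  the complement of a member of \<open>p\<^sub>j\<close>, provided its last entry \<open>x\<close> lies in the starred section
  \<open>{x \<in> C. -x + C \<in> p\<^sub>j}\<close>.
\<close>

section \<open>Ultrafilters on a semigroup\<close>

text \<open>All coordinates of (1) run along one chain, so the only memory passed from one summand
  to the next, and from one block to the next, is the last set used. From (1) to (2) this matches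
  the nesting of the tensor product: once an entry is fixed, every sum above its top set is a legal
  next entry, and those sums form a set in the next ultrafilter. J-sets demand one set of arguments
  shared by all functions, whereas a chain sum evaluates a different function at each set of the
  chain; a variable word repairs this, its variable positions merging into the shared set and its
  constant letters into the additive constant. From (2) to (1) the values at \<open>F\<close> must
  serve every chain through \<open>F\<close> and every function in \<open>F\<close> at once.
  Finiteness of \<open>F\<close> handles the chains, the J-set property handles the functions.
  Starring is forced because a block may receive any number of further summands, so each partial sum
  has to leave room for more.\<close>

lemma beta_sub: "u \<in> beta X \<Longrightarrow> A \<in> u \<Longrightarrow> A \<subseteq> X"
  by (auto simp: beta_def ultrafilter_on_def)

lemma beta_carrier: "u \<in> beta X \<Longrightarrow> X \<in> u"
  by (auto simp: beta_def ultrafilter_on_def)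

lemma beta_empty: "u \<in> beta X \<Longrightarrow> {} \<notin> u"
  by (auto simp: beta_def ultrafilter_on_def)

lemma beta_nonempty: "u \<in> beta X \<Longrightarrow> A \<in> u \<Longrightarrow> A \<noteq> {}"
  using beta_empty by blast

lemma beta_Int: "u \<in> beta X \<Longrightarrow> A \<in> u \<Longrightarrow> B \<in> u \<Longrightarrow> A \<inter> B \<in> u"
  by (auto simp: beta_def ultrafilter_on_def)

lemma beta_mono: "u \<in> beta X \<Longrightarrow> A \<in> u \<Longrightarrow> A \<subseteq> B \<Longrightarrow> B \<subseteq> X \<Longrightarrow> B \<in> u"
  by (auto simp: beta_def ultrafilter_on_def)

lemma beta_compl:
  assumes "u \<in> beta X" "A \<subseteq> X"
  shows "X - A \<in> u \<longleftrightarrow> A \<notin> u"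
proof -
  have "A \<in> u \<Longrightarrow> X - A \<in> u \<Longrightarrow> False"
    using beta_nonempty[OF assms(1) beta_Int[OF assms(1)], of A "X - A"] by blast
  moreover have "A \<in> u \<or> X - A \<in> u"
    using assms by (auto simp: beta_def ultrafilter_on_def)
  ultimately show ?thesis by blast
qed

text \<open>The comprehension inside \<open>X\<close> makes the empty family give \<open>X\<close>
  rather than the universal set.\<close>

lemma beta_finite_INT:
  assumes "u \<in> beta X" "finite I" "\<And>i. i \<in> I \<Longrightarrow> A i \<in> u"
  shows "{x \<in> X. \<forall>i\<in>I. x \<in> A i} \<in> u"
  using assms(2,3)
proof (induction I)
  case empty
  then show ?case using beta_carrier[OF assms(1)] by simp
next
  case (insert i I)
  have "{x \<in> X. \<forall>j\<in>insert i I. x \<in> A j} = A i \<inter> {x \<in> X. \<forall>j\<in>I. x \<in> A j}"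
    using beta_sub[OF assms(1), of "A i"] insert by auto
  then show ?case using insert beta_Int[OF assms(1)] by simp
qed

lemma beta_finite_Union:
  assumes "u \<in> beta X" "finite \<C>" "\<And>C. C \<in> \<C> \<Longrightarrow> C \<subseteq> X" "\<Union>\<C> \<in> u"
  shows "\<exists>C\<in>\<C>. C \<in> u"
proof (rule ccontr)
  assume "\<not> ?thesis"
  then have "\<And>C. C \<in> \<C> \<Longrightarrow> X - C \<in> u"
    using assms(1,3) by (simp add: beta_compl)
  then have "{x \<in> X. \<forall>C\<in>\<C>. x \<in> X - C} \<in> u"
    using beta_finite_INT[OF assms(1,2), of "\<lambda>C. X - C"] by blast
  from beta_nonempty[OF assms(1) beta_Int[OF assms(1) this assms(4)]] show False by blast
qed

lemma beta_eqI:
  assumes "u \<in> beta X" "v \<in> beta X" "u \<subseteq> v"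
  shows "u = v"
proof
  show "v \<subseteq> u"
  proof
    fix A assume "A \<in> v"
    then have "A \<subseteq> X" "X - A \<notin> v"
      using beta_sub[OF assms(2)] beta_compl[OF assms(2)] by auto
    then show "A \<in> u" using beta_compl[OF assms(1)] assms(3) by auto
  qed
qed fact

section \<open>Existence of ultrafilters, the Stone topology and compactness\<close>

lemma ultrafilter_extension:
  assumes sub: "\<F> \<subseteq> Pow X"
    and fip: "\<And>\<G>. finite \<G> \<Longrightarrow> \<G> \<subseteq> \<F> \<Longrightarrow> X \<inter> \<Inter>\<G> \<noteq> {}"
  shows "\<exists>u\<in>beta X. \<F> \<subseteq> u"
proof -
  define fip where "fip \<H> \<longleftrightarrow> (\<forall>\<G>. finite \<G> \<longrightarrow> \<G> \<subseteq> \<H> \<longrightarrow> X \<inter> \<Inter>\<G> \<noteq> {})"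
    for \<H> :: "'a set set"
  define \<A> where "\<A> = {\<H>. \<F> \<subseteq> \<H> \<and> \<H> \<subseteq> Pow X \<and> fip \<H>}"
  have "\<F> \<in> \<A>" using assms by (auto simp: \<A>_def fip_def)
  have "\<exists>M\<in>\<A>. \<forall>\<H>\<in>\<A>. M \<subseteq> \<H> \<longrightarrow> \<H> = M"
  proof (rule subset_Zorn_nonempty)
    show "\<A> \<noteq> {}" using \<open>\<F> \<in> \<A>\<close> by blast
  next
    fix \<C> assume \<C>: "\<C> \<noteq> {}" "subset.chain \<A> \<C>"
    have "fip (\<Union>\<C>)"
      unfolding fip_def
    proof (intro allI impI)
      fix \<G> assume "finite \<G>" "\<G> \<subseteq> \<Union>\<C>"
      then obtain \<H> where "\<H> \<in> \<C>" "\<G> \<subseteq> \<H>"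
        using finite_subset_Union_chain[of \<G> \<C> \<A>] \<C> by blast
      then show "X \<inter> \<Inter>\<G> \<noteq> {}"
        using \<open>finite \<G>\<close> \<C> by (auto simp: subset.chain_def \<A>_def fip_def)
    qed
    then show "\<Union>\<C> \<in> \<A>"
      using \<C> by (auto simp: subset.chain_def \<A>_def) blast+
  qed
  then obtain M where M: "M \<in> \<A>" and max: "\<And>\<H>. \<H> \<in> \<A> \<Longrightarrow> M \<subseteq> \<H> \<Longrightarrow> \<H> = M"
    by blast
  have MX: "M \<subseteq> Pow X" and Mfip: "fip M" and FM: "\<F> \<subseteq> M" using M by (auto simp: \<A>_def)
  \<comment> \<open>By maximality a set can be missing from \<open>M\<close> only because finitely
    many members of \<open>M\<close> already have empty intersection on it.\<close>
  have witness: "\<exists>\<G>. finite \<G> \<and> \<G> \<subseteq> M \<and> X \<inter> A \<inter> \<Inter>\<G> = {}"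
    if "A \<subseteq> X" "A \<notin> M" for A
  proof -
    have "\<not> fip (insert A M)"
    proof
      assume "fip (insert A M)"
      then have "insert A M \<in> \<A>" using MX FM that by (auto simp: \<A>_def)
      then show False using max[of "insert A M"] that by blast
    qed
    then obtain \<G> where "finite \<G>" "\<G> \<subseteq> insert A M" "X \<inter> \<Inter>\<G> = {}"
      by (auto simp: fip_def)
    then show ?thesis
      by (intro exI[of _ "\<G> - {A}"]) auto
  qed
  have dich: "A \<in> M \<or> X - A \<in> M" if AX: "A \<subseteq> X" for A
  proof (rule ccontr)
    assume "\<not> ?thesis"
    then have "A \<notin> M" "X - A \<notin> M" by auto
    obtain \<G> where "finite \<G>" "\<G> \<subseteq> M" "X \<inter> A \<inter> \<Inter>\<G> = {}"
      using witness[OF AX \<open>A \<notin> M\<close>] by blast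
    moreover obtain \<G>' where "finite \<G>'" "\<G>' \<subseteq> M" "X \<inter> (X - A) \<inter> \<Inter>\<G>' = {}"
      using witness[OF Diff_subset \<open>X - A \<notin> M\<close>] by blast
    \<comment> \<open>\<open>\<G>\<close> leaves nothing inside \<open>A\<close> and
      \<open>\<G>'\<close> leaves nothing outside it, so together they refute the finite
      intersection property of \<open>M\<close>.\<close>
    ultimately have "finite (\<G> \<union> \<G>')" "\<G> \<union> \<G>' \<subseteq> M" "X \<inter> \<Inter>(\<G> \<union> \<G>') = {}"
      by (simp_all add: Inter_Un_distrib) blast
    then show False using Mfip by (auto simp: fip_def)
  qed
  have inter: "X \<inter> \<Inter>\<G> \<noteq> {}" if "finite \<G>" "\<G> \<subseteq> M" for \<G>
    using Mfip that by (auto simp: fip_def)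
  have "ultrafilter_on X M"
    unfolding ultrafilter_on_def
  proof (intro conjI ballI allI impI)
    show "M \<subseteq> Pow X" by fact
    show ne: "{} \<notin> M" using inter[of "{{}}"] by auto
    show "X \<in> M" using dich[of X] ne by auto
    show "A \<in> M \<or> X - A \<in> M" if "A \<subseteq> X" for A by (rule dich) fact
    show "A \<inter> B \<in> M" if "A \<in> M" "B \<in> M" for A B
    proof (rule ccontr)
      assume "A \<inter> B \<notin> M"
      then have "X - A \<inter> B \<in> M" using dich[of "A \<inter> B"] MX that by blast
      then show False using inter[of "{A, B, X - A \<inter> B}"] that by auto
    qed
    show "B \<in> M" if "A \<in> M" "A \<subseteq> B \<and> B \<subseteq> X" for A B
    proof (rule ccontr)
      assume "B \<notin> M"
      then have "X - B \<in> M" using dich[of "B"] that by blast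
      then show False using inter[of "{A, X - B}"] that by auto
    qed
  qed
  then show ?thesis using FM by (auto simp: beta_def)
qed

text \<open>Closedness in the Stone topology, phrased through closure points: the sets of all
  \<open>v\<close> with \<open>A \<in> v\<close> are the basic open sets.\<close>

definition closed_beta :: "'a set \<Rightarrow> 'a set set set \<Rightarrow> bool" where
  "closed_beta X C \<longleftrightarrow>
     C \<subseteq> beta X \<and> (\<forall>u\<in>beta X. (\<forall>A\<in>u. \<exists>v\<in>C. A \<in> v) \<longrightarrow> u \<in> C)"

lemma closed_beta_sub: "closed_beta X C \<Longrightarrow> C \<subseteq> beta X"
  by (simp add: closed_beta_def)

lemma closed_betaI:
  "C \<subseteq> beta X \<Longrightarrow> (\<And>u. u \<in> beta X \<Longrightarrow> (\<And>A. A \<in> u \<Longrightarrow> \<exists>v\<in>C. A \<in> v) \<Longrightarrow> u \<in> C)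
    \<Longrightarrow> closed_beta X C"
  by (auto simp: closed_beta_def)

lemma closed_betaD:
  "closed_beta X C \<Longrightarrow> u \<in> beta X \<Longrightarrow> (\<And>A. A \<in> u \<Longrightarrow> \<exists>v\<in>C. A \<in> v) \<Longrightarrow> u \<in> C"
  by (auto simp: closed_beta_def)

lemma closed_beta_basic: "A \<subseteq> X \<Longrightarrow> closed_beta X {u \<in> beta X. A \<in> u}"
proof (rule closed_betaI)
  fix u assume "A \<subseteq> X" "u \<in> beta X" and *: "\<And>B. B \<in> u \<Longrightarrow> \<exists>v\<in>{u \<in> beta X. A \<in> u}. B \<in> v"
  have "A \<in> u"
  proof (rule ccontr)
    assume "A \<notin> u"
    then have "X - A \<in> u" using \<open>A \<subseteq> X\<close> \<open>u \<in> beta X\<close> by (simp add: beta_compl)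
    then obtain v where "v \<in> beta X" "A \<in> v" "X - A \<in> v" using * by blast
    then show False using \<open>A \<subseteq> X\<close> by (simp add: beta_compl)
  qed
  then show "u \<in> {u \<in> beta X. A \<in> u}" using \<open>u \<in> beta X\<close> by simp
qed auto

lemma closed_beta_Inter:
  assumes "\<C> \<noteq> {}" "\<And>C. C \<in> \<C> \<Longrightarrow> closed_beta X C"
  shows "closed_beta X (\<Inter>\<C>)"
proof (rule closed_betaI)
  show "\<Inter>\<C> \<subseteq> beta X" using assms closed_beta_sub by blast
  fix u assume u: "u \<in> beta X" and meets: "\<And>A. A \<in> u \<Longrightarrow> \<exists>v\<in>\<Inter>\<C>. A \<in> v"
  show "u \<in> \<Inter>\<C>"
  proof
    fix C assume "C \<in> \<C>"
    then show "u \<in> C" using meets by (intro closed_betaD[OF assms(2) u]) blast+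
  qed
qed

lemma closed_beta_Int:
  "closed_beta X C \<Longrightarrow> closed_beta X D \<Longrightarrow> closed_beta X (C \<inter> D)"
  using closed_beta_Inter[of "{C, D}" X] by auto

text \<open>A common point is any ultrafilter extending the filters that belong to the closed sets;
  closedness brings it back into each of them.\<close>

lemma beta_compact:
  assumes ne: "\<C> \<noteq> {}" and cl: "\<And>C. C \<in> \<C> \<Longrightarrow> closed_beta X C"
    and fip: "\<And>\<D>. finite \<D> \<Longrightarrow> \<D> \<noteq> {} \<Longrightarrow> \<D> \<subseteq> \<C> \<Longrightarrow> \<Inter>\<D> \<noteq> {}"
  shows "\<Inter>\<C> \<noteq> {}"
proof -
  \<comment> \<open>The filter of \<open>C\<close>: the sets shared by all ultrafilters in
    \<open>C\<close>.\<close>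
  define ker where "ker C = {A. A \<subseteq> X \<and> (\<forall>v\<in>C. A \<in> v)}" for C
  have "\<exists>u\<in>beta X. (\<Union>C\<in>\<C>. ker C) \<subseteq> u"
  proof (rule ultrafilter_extension)
    show "(\<Union>C\<in>\<C>. ker C) \<subseteq> Pow X" by (auto simp: ker_def)
    fix \<G> assume \<G>: "finite \<G>" "\<G> \<subseteq> (\<Union>C\<in>\<C>. ker C)"
    then have "\<forall>A\<in>\<G>. \<exists>C\<in>\<C>. A \<in> ker C" by blast
    then obtain c where c: "\<And>A. A \<in> \<G> \<Longrightarrow> c A \<in> \<C> \<and> A \<in> ker (c A)" by metis
    \<comment> \<open>\<open>C0\<close> keeps the intersected family nonempty even if
      \<open>\<G>\<close> is empty.\<close>
    obtain C0 where "C0 \<in> \<C>" using ne by blast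
    have "\<Inter>(insert C0 (c ` \<G>)) \<noteq> {}"
      using \<G> c \<open>C0 \<in> \<C>\<close> by (intro fip) auto
    then obtain v where v: "v \<in> C0" "\<And>A. A \<in> \<G> \<Longrightarrow> v \<in> c A" by auto
    then have "v \<in> beta X" using cl \<open>C0 \<in> \<C>\<close> closed_beta_sub by blast
    have "\<And>A. A \<in> \<G> \<Longrightarrow> A \<in> v" using v c by (auto simp: ker_def)
    then have "{x \<in> X. \<forall>A\<in>\<G>. x \<in> A} \<in> v"
      by (rule beta_finite_INT[OF \<open>v \<in> beta X\<close> \<G>(1)])
    from beta_nonempty[OF \<open>v \<in> beta X\<close> this] show "X \<inter> \<Inter>\<G> \<noteq> {}" by blast
  qed
  then obtain u where u: "u \<in> beta X" "\<And>C. C \<in> \<C> \<Longrightarrow> ker C \<subseteq> u" by blast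
  have "u \<in> C" if C: "C \<in> \<C>" for C
  proof (rule closed_betaD[OF cl[OF C] u(1)])
    fix A assume "A \<in> u"
    then have A: "A \<subseteq> X" "X - A \<notin> u"
      using beta_sub[OF u(1)] beta_compl[OF u(1)] by auto
    have "X - A \<notin> ker C" using A u(2)[OF C] by blast
    then obtain v where "v \<in> C" "X - A \<notin> v" by (auto simp: ker_def)
    moreover from \<open>v \<in> C\<close> have "v \<in> beta X" using closed_beta_sub[OF cl[OF C]] by blast
    ultimately show "\<exists>v\<in>C. A \<in> v" using A by (auto simp: beta_compl)
  qed
  then show ?thesis by blast
qed

lemma chain_finite_Inter:
  assumes "finite \<D>" "\<D> \<noteq> {}" "\<And>C D. C \<in> \<D> \<Longrightarrow> D \<in> \<D> \<Longrightarrow> C \<subseteq> D \<or> D \<subseteq> C"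
  shows "\<Inter>\<D> \<in> \<D>"
  using assms
proof (induction rule: finite_ne_induct)
  case (insert D \<D>)
  then have "\<Inter>\<D> \<in> \<D>" by blast
  then have "D \<subseteq> \<Inter>\<D> \<or> \<Inter>\<D> \<subseteq> D" using insert.prems by (meson insertI1 insertI2)
  then show ?case
  proof
    assume "D \<subseteq> \<Inter>\<D>"
    then have "\<Inter>(insert D \<D>) = D" by auto
    then show ?thesis by simp
  next
    assume "\<Inter>\<D> \<subseteq> D"
    then have "\<Inter>(insert D \<D>) = \<Inter>\<D>" by auto
    then show ?thesis using \<open>\<Inter>\<D> \<in> \<D>\<close> by simp
  qed
qed simp

text \<open>Zorn's lemma for reverse inclusion; compactness keeps the intersection of a chain
  nonempty. The predicate \<open>P\<close> is instantiated once by "subsemigroup" and once by "left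
  ideal".\<close>

lemma minimal_closed_beta:
  assumes "closed_beta X C" "C \<noteq> {}" "P C"
    and P: "\<And>\<D>. \<D> \<noteq> {} \<Longrightarrow> (\<And>D. D \<in> \<D> \<Longrightarrow> P D) \<Longrightarrow> P (\<Inter>\<D>)"
  obtains M where "M \<subseteq> C" "closed_beta X M" "M \<noteq> {}" "P M"
    "\<And>N. N \<subseteq> M \<Longrightarrow> closed_beta X N \<Longrightarrow> N \<noteq> {} \<Longrightarrow> P N \<Longrightarrow> N = M"
proof -
  define \<A> where "\<A> = {D. D \<subseteq> C \<and> closed_beta X D \<and> D \<noteq> {} \<and> P D}"
  define R where "R = (\<lambda>A B. (B :: 'a set set set) \<subseteq> A)"
  have "\<exists>m\<in>\<A>. \<forall>a\<in>\<A>. R m a \<longrightarrow> a = m"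
  proof (rule predicate_Zorn)
    show "partial_order_on \<A> (relation_of R \<A>)"
      by (rule partial_order_on_relation_ofI) (auto simp: R_def)
    fix \<D> assume D: "\<D> \<in> Chains (relation_of R \<A>)"
    then have chain: "\<And>A B. A \<in> \<D> \<Longrightarrow> B \<in> \<D> \<Longrightarrow> A \<subseteq> B \<or> B \<subseteq> A"
      and sub: "\<D> \<subseteq> \<A>"
      by (auto simp: Chains_def relation_of_def R_def)
    show "\<exists>u\<in>\<A>. \<forall>a\<in>\<D>. R a u"
    proof (cases "\<D> = {}")
      case True
      then show ?thesis using assms by (auto simp: \<A>_def)
    next
      case False
      have "\<Inter>\<D> \<noteq> {}"
      proof (rule beta_compact[OF False])
        show "closed_beta X D" if "D \<in> \<D>" for D using that sub by (auto simp: \<A>_def)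
        fix \<E> assume \<E>: "finite \<E>" "\<E> \<noteq> {}" "\<E> \<subseteq> \<D>"
        then have "\<Inter>\<E> \<in> \<E>" by (intro chain_finite_Inter) (use chain in blast)+
        then show "\<Inter>\<E> \<noteq> {}" using \<E> sub by (auto simp: \<A>_def)
      qed
      moreover have "closed_beta X (\<Inter>\<D>)" "P (\<Inter>\<D>)"
        using False sub by (auto simp: \<A>_def intro!: closed_beta_Inter P)
      moreover have "\<Inter>\<D> \<subseteq> C" using False sub by (auto simp: \<A>_def)
      ultimately have "\<Inter>\<D> \<in> \<A>" by (simp add: \<A>_def)
      then show ?thesis by (auto simp: R_def)
    qed
  qed
  then obtain M where "M \<in> \<A>" "\<And>a. a \<in> \<A> \<Longrightarrow> a \<subseteq> M \<Longrightarrow> a = M" by (auto simp: R_def)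
  then show thesis by (intro that[of M]) (auto simp: \<A>_def)
qed

section \<open>Products of ultrafilters, uniformly for addition on \<open>PN\<close> and
  concatenation of words\<close>

definition uf_mult :: "'a set \<Rightarrow> ('a \<Rightarrow> 'a \<Rightarrow> 'a) \<Rightarrow> 'a set set \<Rightarrow> 'a set set \<Rightarrow> 'a set set" where
  "uf_mult X f p q = {A. A \<subseteq> X \<and> {x \<in> X. {y \<in> X. f x y \<in> A} \<in> q} \<in> p}"

lemma uf_plus_eq_mult: "uf_plus = uf_mult PN (+)"
  by (simp add: fun_eq_iff uf_plus_def uf_mult_def)

lemma uf_mult_beta:
  assumes "\<And>x y. x \<in> X \<Longrightarrow> y \<in> X \<Longrightarrow> f x y \<in> X" and p: "p \<in> beta X" and q: "q \<in> beta X"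
  shows "uf_mult X f p q \<in> beta X"
proof -
  have "{x \<in> X. {y \<in> X. f x y \<in> X} \<in> q} = X"
    using assms(1) beta_carrier[OF q] by (auto simp: Collect_conj_eq[symmetric] cong: conj_cong)
  then have 1: "X \<in> uf_mult X f p q" by (simp add: uf_mult_def beta_carrier[OF p])
  have 2: "{} \<notin> uf_mult X f p q" using beta_empty[OF q] beta_empty[OF p] by (simp add: uf_mult_def)
  have 3: "A \<inter> B \<in> uf_mult X f p q" if "A \<in> uf_mult X f p q" "B \<in> uf_mult X f p q" for A B
  proof -
    have "{x \<in> X. {y \<in> X. f x y \<in> A} \<in> q} \<inter> {x \<in> X. {y \<in> X. f x y \<in> B} \<in> q} \<in> p"
      using that beta_Int[OF p] by (simp add: uf_mult_def)
    moreover have "{y \<in> X. f x y \<in> A \<inter> B} = {y \<in> X. f x y \<in> A} \<inter> {y \<in> X. f x y \<in> B}" for x by blast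
    ultimately have "{x \<in> X. {y \<in> X. f x y \<in> A \<inter> B} \<in> q} \<in> p"
      by (elim beta_mono[OF p]) (auto intro: beta_Int[OF q])
    then show ?thesis using that by (auto simp: uf_mult_def)
  qed
  have 4: "B \<in> uf_mult X f p q" if "A \<in> uf_mult X f p q" "A \<subseteq> B" "B \<subseteq> X" for A B
  proof -
    have "{y \<in> X. f x y \<in> B} \<in> q" if "{y \<in> X. f x y \<in> A} \<in> q" for x
      using that \<open>A \<subseteq> B\<close> by (elim beta_mono[OF q]) auto
    then have sub: "{x \<in> X. {y \<in> X. f x y \<in> A} \<in> q} \<subseteq> {x \<in> X. {y \<in> X. f x y \<in> B} \<in> q}" by blast
    have "{x \<in> X. {y \<in> X. f x y \<in> A} \<in> q} \<in> p" using that(1) by (simp add: uf_mult_def)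
    from beta_mono[OF p this sub] show ?thesis using that(3) by (simp add: uf_mult_def)
  qed
  have 5: "A \<in> uf_mult X f p q \<or> X - A \<in> uf_mult X f p q" if "A \<subseteq> X" for A
  proof -
    have "{y \<in> X. f x y \<in> X - A} = X - {y \<in> X. f x y \<in> A}" if "x \<in> X" for x
      using assms(1)[OF that] by blast
    then have "{y \<in> X. f x y \<in> X - A} \<in> q \<longleftrightarrow> {y \<in> X. f x y \<in> A} \<notin> q" if "x \<in> X" for x
      using that beta_compl[OF q, of "{y \<in> X. f x y \<in> A}" for x] by simp
    then have "{x \<in> X. {y \<in> X. f x y \<in> X - A} \<in> q} = X - {x \<in> X. {y \<in> X. f x y \<in> A} \<in> q}"
      by blast
    moreover have "X - {x \<in> X. {y \<in> X. f x y \<in> A} \<in> q} \<in> p \<longleftrightarrow>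
        {x \<in> X. {y \<in> X. f x y \<in> A} \<in> q} \<notin> p"
      by (rule beta_compl[OF p]) blast
    ultimately show ?thesis using \<open>A \<subseteq> X\<close> by (auto simp only: uf_mult_def mem_Collect_eq)
  qed
  show ?thesis unfolding beta_def ultrafilter_on_def
    using 1 2 3 4 5 by (auto simp: uf_mult_def)
qed

locale carrier_semigroup =
  fixes X :: "'a set" and f :: "'a \<Rightarrow> 'a \<Rightarrow> 'a" (infixl \<open>\<cdot>\<close> 70)
  assumes closed: "x \<in> X \<Longrightarrow> y \<in> X \<Longrightarrow> x \<cdot> y \<in> X"
    and assoc: "x \<in> X \<Longrightarrow> y \<in> X \<Longrightarrow> z \<in> X \<Longrightarrow> (x \<cdot> y) \<cdot> z = x \<cdot> (y \<cdot> z)"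
begin

abbreviation uf_prod (infixl \<open>\<odot>\<close> 70) where "uf_prod \<equiv> uf_mult X f"

lemma prod_beta: "p \<in> beta X \<Longrightarrow> q \<in> beta X \<Longrightarrow> p \<odot> q \<in> beta X"
  by (rule uf_mult_beta) (rule closed)

lemma mem_prod: "A \<in> p \<odot> q \<longleftrightarrow> A \<subseteq> X \<and> {x \<in> X. {y \<in> X. x \<cdot> y \<in> A} \<in> q} \<in> p"
  by (simp add: uf_mult_def)

lemma prod_assoc: "(p \<odot> q) \<odot> r = p \<odot> (q \<odot> r)"
proof (rule set_eqI)
  fix A
  let ?L = "{x \<in> X. {y \<in> X. x \<cdot> y \<in> {x \<in> X. {y \<in> X. x \<cdot> y \<in> A} \<in> r}} \<in> q}"
  let ?R = "{x \<in> X. {y \<in> X. x \<cdot> y \<in> A} \<in> q \<odot> r}"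
  have eq: "{z \<in> X. (x \<cdot> y) \<cdot> z \<in> A} = {z \<in> X. y \<cdot> z \<in> {y \<in> X. x \<cdot> y \<in> A}}"
    if "x \<in> X" "y \<in> X" for x y
    using that by (auto simp: assoc closed)
  have "{y \<in> X. x \<cdot> y \<in> {x \<in> X. {y \<in> X. x \<cdot> y \<in> A} \<in> r}} =
      {y \<in> X. {z \<in> X. y \<cdot> z \<in> {y \<in> X. x \<cdot> y \<in> A}} \<in> r}" if "x \<in> X" for x
    using that eq closed by auto
  then have "?L = ?R" by (auto simp: mem_prod)
  then show "A \<in> (p \<odot> q) \<odot> r \<longleftrightarrow> A \<in> p \<odot> (q \<odot> r)"
    by (simp add: mem_prod[of _ _ r] mem_prod[of _ p] mem_prod[of "{x \<in> X. {y \<in> X. x \<cdot> y \<in> A} \<in> r}" p])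
qed

text \<open>Right multiplication by \<open>p\<close> is continuous, since
  \<open>A \<in> r \<odot> p\<close> means that a set depending only on \<open>A\<close> and
  \<open>p\<close> lies in \<open>r\<close>; a continuous image of a compact set is closed.\<close>

lemma closed_beta_right_mult:
  assumes C: "closed_beta X C" and p: "p \<in> beta X"
  shows "closed_beta X ((\<lambda>r. r \<odot> p) ` C)"
proof (rule closed_betaI)
  show "(\<lambda>r. r \<odot> p) ` C \<subseteq> beta X" using C p prod_beta closed_beta_sub by blast
  fix u assume u: "u \<in> beta X" and meets: "\<And>A. A \<in> u \<Longrightarrow> \<exists>v\<in>(\<lambda>r. r \<odot> p) ` C. A \<in> v"
  \<comment> \<open>Solutions \<open>r\<close> of \<open>u = r \<odot> p\<close> in \<open>C\<close>
    are approximated one member \<open>A\<close> of \<open>u\<close> at a time; finitely many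
    members are treated through their intersection, which is again in \<open>u\<close>.\<close>
  define N where "N A = C \<inter> {r \<in> beta X. {x \<in> X. {y \<in> X. x \<cdot> y \<in> A} \<in> p} \<in> r}" for A
  have N: "r \<in> N A \<longleftrightarrow> r \<in> C \<and> A \<in> r \<odot> p" if "A \<in> u" for r A
    using beta_sub[OF u that] closed_beta_sub[OF C] by (auto simp: N_def mem_prod)
  have "\<Inter>(N ` u) \<noteq> {}"
  proof (rule beta_compact[where X = X])
    show "N ` u \<noteq> {}" using beta_carrier[OF u] by blast
    show "closed_beta X D" if "D \<in> N ` u" for D
      using that C by (auto simp: N_def intro!: closed_beta_Int closed_beta_basic)
    fix \<D> assume \<D>: "finite \<D>" "\<D> \<noteq> {}" "\<D> \<subseteq> N ` u"
    then obtain \<G> where \<G>: "finite \<G>" "\<G> \<subseteq> u" "\<D> = N ` \<G>" by (meson finite_subset_image)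
    then have G: "{x \<in> X. \<forall>A\<in>\<G>. x \<in> A} \<in> u" by (intro beta_finite_INT[OF u]) auto
    then obtain r where r: "r \<in> C" "{x \<in> X. \<forall>A\<in>\<G>. x \<in> A} \<in> r \<odot> p" using meets by blast
    then have rp: "r \<odot> p \<in> beta X" using C p prod_beta closed_beta_sub by blast
    have "r \<in> N A" if "A \<in> \<G>" for A
    proof -
      have "A \<in> u" using that \<G> by blast
      then have "A \<in> r \<odot> p" using that beta_sub[OF u] by (intro beta_mono[OF rp r(2)]) auto
      then show ?thesis using N \<open>A \<in> u\<close> r by simp
    qed
    then show "\<Inter>\<D> \<noteq> {}" using \<G> by blast
  qed
  then obtain r where r: "\<And>A. A \<in> u \<Longrightarrow> r \<in> N A" by blast
  then have "r \<in> C" "u \<subseteq> r \<odot> p" using N beta_carrier[OF u] by blast+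
  moreover from this have "r \<odot> p \<in> beta X" using C p prod_beta closed_beta_sub by blast
  ultimately show "u \<in> (\<lambda>r. r \<odot> p) ` C" using beta_eqI[OF u] by blast
qed

text \<open>A fibre of the same continuous map: one set \<open>S\<close>, independent of
  \<open>r\<close>, decides whether \<open>A \<in> r \<odot> p\<close>, and a closure point of the
  fibre cannot disagree about it.\<close>

lemma closed_beta_solutions:
  assumes M: "closed_beta X M" and p: "p \<in> beta X" and u: "u \<in> beta X"
  shows "closed_beta X {r \<in> M. r \<odot> p = u}"
proof (rule closed_betaI)
  show "{r \<in> M. r \<odot> p = u} \<subseteq> beta X" using closed_beta_sub[OF M] by blast
  fix v assume v: "v \<in> beta X" and meets: "\<And>A. A \<in> v \<Longrightarrow> \<exists>r\<in>{r \<in> M. r \<odot> p = u}. A \<in> r"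
  have "v \<in> M" by (rule closed_betaD[OF M v]) (use meets in blast)
  have "u \<subseteq> v \<odot> p"
  proof
    fix A assume A: "A \<in> u"
    define S where "S = {x \<in> X. {y \<in> X. x \<cdot> y \<in> A} \<in> p}"
    have "S \<subseteq> X" by (auto simp: S_def)
    have "S \<in> v"
    proof (rule ccontr)
      assume "S \<notin> v"
      then have "X - S \<in> v" using beta_compl[OF v \<open>S \<subseteq> X\<close>] by simp
      then obtain r where r: "r \<in> M" "r \<odot> p = u" "X - S \<in> r" using meets by blast
      then have "S \<in> r" using A mem_prod[of A r p] by (simp add: S_def)
      moreover have "r \<in> beta X" using r closed_beta_sub[OF M] by blast
      ultimately show False using r(3) \<open>S \<subseteq> X\<close> by (simp add: beta_compl)
    qed
    then show "A \<in> v \<odot> p" using beta_sub[OF u A] by (simp add: mem_prod S_def)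
  qed
  then show "v \<in> {r \<in> M. r \<odot> p = u}"
    using \<open>v \<in> M\<close> beta_eqI[OF u prod_beta[OF v p]] by simp
qed

text \<open>The Ellis-Numakura argument. In a minimal closed subsemigroup \<open>M\<close> the set
  of all \<open>r \<odot> p\<close> with \<open>r \<in> M\<close> is all of \<open>M\<close>; hence
  the \<open>r\<close> with \<open>r \<odot> p = p\<close> form a nonempty closed subsemigroup,
  again all of \<open>M\<close>, and \<open>p\<close> is among them.\<close>

lemma idempotent_exists:
  assumes C: "closed_beta X C" "C \<noteq> {}" and mult: "\<And>p q. p \<in> C \<Longrightarrow> q \<in> C \<Longrightarrow> p \<odot> q \<in> C"
  obtains p where "p \<in> C" "p \<odot> p = p"
proof -
  have CC: "\<forall>p\<in>C. \<forall>q\<in>C. p \<odot> q \<in> C" using mult by blast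
  have inter: "\<forall>p\<in>\<Inter>\<D>. \<forall>q\<in>\<Inter>\<D>. p \<odot> q \<in> \<Inter>\<D>"
    if "\<And>D. D \<in> \<D> \<Longrightarrow> \<forall>p\<in>D. \<forall>q\<in>D. p \<odot> q \<in> D" for \<D>
    using that by blast
  obtain M where M: "M \<subseteq> C" "closed_beta X M" "M \<noteq> {}" "\<forall>p\<in>M. \<forall>q\<in>M. p \<odot> q \<in> M"
    and min: "\<And>N. N \<subseteq> M \<Longrightarrow> closed_beta X N \<Longrightarrow> N \<noteq> {} \<Longrightarrow> \<forall>p\<in>N. \<forall>q\<in>N. p \<odot> q \<in> N \<Longrightarrow> N = M"
    by (rule minimal_closed_beta[OF C, where P = "\<lambda>D. \<forall>p\<in>D. \<forall>q\<in>D. p \<odot> q \<in> D", OF CC inter]) auto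
  obtain p where p: "p \<in> M" using M by blast
  then have pb: "p \<in> beta X" using M closed_beta_sub by blast
  have "(\<lambda>r. r \<odot> p) ` M = M"
  proof (rule min)
    show "closed_beta X ((\<lambda>r. r \<odot> p) ` M)" by (rule closed_beta_right_mult[OF M(2) pb])
    show "\<forall>q\<in>(\<lambda>r. r \<odot> p) ` M. \<forall>r\<in>(\<lambda>r. r \<odot> p) ` M. q \<odot> r \<in> (\<lambda>r. r \<odot> p) ` M"
      using M(4) p by (auto simp: prod_assoc[symmetric])
  qed (use M p in auto)
  then have "p \<in> (\<lambda>r. r \<odot> p) ` M" using p by simp
  then obtain r where "r \<in> M" "r \<odot> p = p" by auto
  have "{r \<in> M. r \<odot> p = p} = M"
  proof (rule min)
    show "closed_beta X {r \<in> M. r \<odot> p = p}" by (rule closed_beta_solutions[OF M(2) pb pb])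
    show "\<forall>q\<in>{r \<in> M. r \<odot> p = p}. \<forall>r\<in>{r \<in> M. r \<odot> p = p}. q \<odot> r \<in> {r \<in> M. r \<odot> p = p}"
      using M(4) by (auto simp: prod_assoc)
  qed (use \<open>r \<in> M\<close> \<open>r \<odot> p = p\<close> in auto)
  then show thesis using that[of p] p M by blast
qed

text \<open>The idempotents of a minimal closed left ideal are minimal for the order
  \<open>q \<le> p \<longleftrightarrow> p \<odot> q = q = q \<odot> p\<close>.\<close>

lemma minimal_idempotent_exists:
  assumes C: "closed_beta X C" "C \<noteq> {}" and mult: "\<And>p q. p \<in> C \<Longrightarrow> q \<in> C \<Longrightarrow> p \<odot> q \<in> C"
  obtains p where "p \<in> C" "p \<odot> p = p"
    "\<And>q. q \<in> C \<Longrightarrow> q \<odot> q = q \<Longrightarrow> p \<odot> q = q \<Longrightarrow> q \<odot> p = q \<Longrightarrow> q = p"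
proof -
  have "\<forall>p\<in>C. \<forall>q\<in>C. p \<odot> q \<in> C" using mult by blast
  then obtain L where L: "L \<subseteq> C" "closed_beta X L" "L \<noteq> {}" "\<forall>p\<in>C. \<forall>q\<in>L. p \<odot> q \<in> L"
    and min: "\<And>N. N \<subseteq> L \<Longrightarrow> closed_beta X N \<Longrightarrow> N \<noteq> {} \<Longrightarrow> \<forall>p\<in>C. \<forall>q\<in>N. p \<odot> q \<in> N \<Longrightarrow> N = L"
    by (rule minimal_closed_beta[OF C, where P = "\<lambda>D. \<forall>p\<in>C. \<forall>q\<in>D. p \<odot> q \<in> D"]) blast+
  obtain p where p: "p \<in> L" "p \<odot> p = p"
    by (rule idempotent_exists[OF L(2,3)]) (use L in blast)+
  show thesis
  proof (rule that[of p])
    fix q assume q: "q \<in> C" "q \<odot> q = q" "p \<odot> q = q" "q \<odot> p = q"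
    then have "q \<in> L" using L p by metis
    have "q \<in> beta X" using q C closed_beta_sub by blast
    \<comment> \<open>Since \<open>q \<in> L\<close>, this is a closed left ideal inside the minimal
      one. It yields \<open>p = r \<odot> q\<close>, so that \<open>q\<close> absorbs into
      \<open>p\<close> and \<open>p = p \<odot> q = q\<close>.\<close>
    have "(\<lambda>r. r \<odot> q) ` C = L"
    proof (rule min)
      show "closed_beta X ((\<lambda>r. r \<odot> q) ` C)" by (rule closed_beta_right_mult[OF C(1) \<open>q \<in> beta X\<close>])
      show "\<forall>p\<in>C. \<forall>r\<in>(\<lambda>r. r \<odot> q) ` C. p \<odot> r \<in> (\<lambda>r. r \<odot> q) ` C"
        using mult by (auto simp: prod_assoc[symmetric])
    qed (use L C \<open>q \<in> L\<close> in auto)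
    then obtain r where "p = r \<odot> q" using p by blast
    then have "p \<odot> q = p" using q by (simp add: prod_assoc)
    then show "q = p" using q by simp
  qed (use p L in auto)
qed

lemma right_ideal_mem_prod:
  assumes "p \<in> beta X" "q \<in> beta X" "V \<in> p" "\<And>x y. x \<in> V \<Longrightarrow> y \<in> X \<Longrightarrow> x \<cdot> y \<in> V"
  shows "V \<in> p \<odot> q"
proof -
  have "V \<subseteq> X" using assms beta_sub by blast
  have "{y \<in> X. x \<cdot> y \<in> V} = X" if "x \<in> V" for x using that assms by blast
  then have "V \<subseteq> {x \<in> X. {y \<in> X. x \<cdot> y \<in> V} \<in> q}"
    using \<open>V \<subseteq> X\<close> beta_carrier[OF assms(2)] by auto
  then show ?thesis using beta_mono[OF assms(1,3)] \<open>V \<subseteq> X\<close> by (simp add: mem_prod)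
qed

text \<open>Serves two purposes: \<open>S = V\<close> for subsemigroups and \<open>S = X\<close> for
  left ideals.\<close>

lemma left_ideal_mem_prod:
  assumes "p \<in> beta X" "q \<in> beta X" "S \<in> p" "V \<in> q"
    "\<And>x y. x \<in> S \<Longrightarrow> y \<in> V \<Longrightarrow> x \<cdot> y \<in> V"
  shows "V \<in> p \<odot> q"
proof -
  have V: "V \<subseteq> X" and S: "S \<subseteq> X" using assms beta_sub by blast+
  have "{y \<in> X. x \<cdot> y \<in> V} \<in> q" if "x \<in> S" for x
    using that assms(5) V by (intro beta_mono[OF assms(2,4)]) auto
  then have "S \<subseteq> {x \<in> X. {y \<in> X. x \<cdot> y \<in> V} \<in> q}" using S by auto
  then show ?thesis using beta_mono[OF assms(1,3)] V by (simp add: mem_prod)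
qed

end

section \<open>Images of ultrafilters under a map, and under a homomorphism\<close>

definition uf_map :: "'a set \<Rightarrow> ('a \<Rightarrow> 'a) \<Rightarrow> 'a set set \<Rightarrow> 'a set set" where
  "uf_map X e u = {A. A \<subseteq> X \<and> {x \<in> X. e x \<in> A} \<in> u}"

lemma uf_map_beta:
  assumes "\<And>x. x \<in> X \<Longrightarrow> e x \<in> X" and u: "u \<in> beta X"
  shows "uf_map X e u \<in> beta X"
proof -
  have "{x \<in> X. e x \<in> X} = X" using assms(1) by blast
  then have 1: "X \<in> uf_map X e u" using beta_carrier[OF u] by (simp add: uf_map_def)
  have 2: "{} \<notin> uf_map X e u" using beta_empty[OF u] by (simp add: uf_map_def)
  have "{x \<in> X. e x \<in> A \<inter> B} = {x \<in> X. e x \<in> A} \<inter> {x \<in> X. e x \<in> B}" for A B by blast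
  then have 3: "A \<inter> B \<in> uf_map X e u" if "A \<in> uf_map X e u" "B \<in> uf_map X e u" for A B
    using that beta_Int[OF u] by (auto simp: uf_map_def)
  have 4: "B \<in> uf_map X e u" if "A \<in> uf_map X e u" "A \<subseteq> B" "B \<subseteq> X" for A B
  proof -
    have "{x \<in> X. e x \<in> B} \<in> u"
      by (rule beta_mono[OF u, of "{x \<in> X. e x \<in> A}"]) (use that in \<open>auto simp: uf_map_def\<close>)
    then show ?thesis using that by (simp add: uf_map_def)
  qed
  have "{x \<in> X. e x \<in> X - A} = X - {x \<in> X. e x \<in> A}" for A using assms(1) by blast
  then have 5: "A \<in> uf_map X e u \<or> X - A \<in> uf_map X e u" if "A \<subseteq> X" for A
    using that beta_compl[OF u, of "{x \<in> X. e x \<in> A}"] by (auto simp: uf_map_def)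
  show ?thesis unfolding beta_def ultrafilter_on_def
    using 1 2 3 4 5 by (auto simp: uf_map_def)
qed

lemma uf_map_mult:
  assumes "\<And>x. x \<in> X \<Longrightarrow> e x \<in> X" "\<And>x y. x \<in> X \<Longrightarrow> y \<in> X \<Longrightarrow> f x y \<in> X"
    and "\<And>x y. x \<in> X \<Longrightarrow> y \<in> X \<Longrightarrow> e (f x y) = f (e x) (e y)"
  shows "uf_map X e (uf_mult X f p q) = uf_mult X f (uf_map X e p) (uf_map X e q)"
proof (rule set_eqI)
  fix A
  have "{y \<in> X. f x y \<in> {z \<in> X. e z \<in> A}} = {y \<in> X. e y \<in> {y \<in> X. f (e x) y \<in> A}}"
    if "x \<in> X" for x
    using that assms by auto
  then have eq: "{x \<in> X. {y \<in> X. f x y \<in> {z \<in> X. e z \<in> A}} \<in> q} =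
      {x \<in> X. e x \<in> {x \<in> X. {y \<in> X. f x y \<in> A} \<in> uf_map X e q}}"
    using assms(1) by (auto simp: uf_map_def)
  have "A \<in> uf_map X e (uf_mult X f p q) \<longleftrightarrow>
      A \<subseteq> X \<and> {x \<in> X. {y \<in> X. f x y \<in> {z \<in> X. e z \<in> A}} \<in> q} \<in> p"
    by (auto simp: uf_map_def uf_mult_def)
  also have "\<dots> \<longleftrightarrow> A \<in> uf_mult X f (uf_map X e p) (uf_map X e q)"
    unfolding eq by (auto simp: uf_map_def[of X e p] uf_mult_def)
  finally show "A \<in> uf_map X e (uf_mult X f p q) \<longleftrightarrow> A \<in> uf_mult X f (uf_map X e p) (uf_map X e q)" .
qed

section \<open>Variable words\<close>

lemma principal_beta: "x \<in> X \<Longrightarrow> {A. A \<subseteq> X \<and> x \<in> A} \<in> beta X"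
  by (auto simp: beta_def ultrafilter_on_def)

text \<open>The letter \<^const>\<open>None\<close> is the variable. The variable word is drawn from an
  idempotent \<open>q\<close> below a minimal idempotent \<open>p\<close> of the constant words: substituting a letter fixes
  \<open>p\<close> and maps \<open>q\<close> to an idempotent below \<open>p\<close>, hence to \<open>p\<close>.\<close>

theorem infinite_Hales_Jewett:
  fixes \<Sigma> :: "'a set" and \<C> :: "'a list set set"
  assumes "finite \<Sigma>" "finite \<C>" "lists \<Sigma> \<subseteq> \<Union>\<C>"
  shows "\<exists>v\<in>lists (insert None (Some ` \<Sigma>)). None \<in> set v \<and>
    (\<exists>C\<in>\<C>. \<forall>a\<in>\<Sigma>. map (case_option a id) v \<in> C)"
proof -
  define X where "X = lists (insert None (Some ` \<Sigma>))"
  define S where "S = map Some ` lists \<Sigma>"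
  define V where "V = {v \<in> X. None \<in> set v}"
  \<comment> \<open>Wrapping the result in \<open>Some\<close> makes substitution an endomorphism of
    \<open>X\<close>, with the constant words as fixed points.\<close>
  define e where "e a = map (\<lambda>x. Some (case_option a id x))" for a :: 'a
  interpret carrier_semigroup X "(@)"
    by unfold_locales (auto simp: X_def)
  let ?m = "uf_mult X (@)"
  have "S \<subseteq> X" "V \<subseteq> X" by (auto simp: S_def V_def X_def)
  note clS = closed_beta_basic[OF \<open>S \<subseteq> X\<close>] and clV = closed_beta_basic[OF \<open>V \<subseteq> X\<close>]
  have "x @ y \<in> S" if "x \<in> S" "y \<in> S" for x y
    using that by (auto simp: S_def simp flip: map_append intro!: imageI)
  then have Smult: "?m p q \<in> {u \<in> beta X. S \<in> u}"
    if "p \<in> {u \<in> beta X. S \<in> u}" "q \<in> {u \<in> beta X. S \<in> u}" for p q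
    using that prod_beta[of p q] left_ideal_mem_prod[of p q S S] by simp
  have "[] \<in> S" by (auto simp: S_def)
  then have "{A. A \<subseteq> X \<and> [] \<in> A} \<in> {u \<in> beta X. S \<in> u}"
    using principal_beta[of "[]" X] \<open>S \<subseteq> X\<close> by auto
  then have Sne: "{u \<in> beta X. S \<in> u} \<noteq> {}" by blast
  obtain p where "p \<in> {u \<in> beta X. S \<in> u}" and pp: "?m p p = p"
    and min: "\<And>q. q \<in> {u \<in> beta X. S \<in> u} \<Longrightarrow> ?m q q = q \<Longrightarrow> ?m p q = q \<Longrightarrow> ?m q p = q \<Longrightarrow> q = p"
    by (rule minimal_idempotent_exists[OF clS Sne Smult]) (assumption | rule that)+
  then have p: "p \<in> beta X" "S \<in> p" by auto

  have Vl: "x @ y \<in> V" if "x \<in> X" "y \<in> V" for x y using that by (auto simp: V_def X_def)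
  have Vr: "x @ y \<in> V" if "x \<in> V" "y \<in> X" for x y using that by (auto simp: V_def X_def)
  \<comment> \<open>Members of \<open>W\<close> absorb \<open>p\<close> on the right because
    \<open>p\<close> is idempotent. Closure under products comes from the words with a variable
    being a left ideal.\<close>
  define W where "W = (\<lambda>r. ?m r p) ` {u \<in> beta X. V \<in> u}"
  have clW: "closed_beta X W" unfolding W_def by (rule closed_beta_right_mult[OF clV p(1)])
  have "[None] \<in> V" by (auto simp: V_def X_def)
  then have "{A. A \<subseteq> X \<and> [None] \<in> A} \<in> {u \<in> beta X. V \<in> u}"
    using principal_beta[of "[None]" X] \<open>V \<subseteq> X\<close> by auto
  then have Wne: "W \<noteq> {}" by (auto simp: W_def)
  have Wmult: "?m q r \<in> W" if qr: "q \<in> W" "r \<in> W" for q r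
  proof -
    obtain q' r' where *: "q = ?m q' p" "r = ?m r' p" "q' \<in> beta X" "V \<in> q'" "r' \<in> beta X" "V \<in> r'"
      using qr by (auto simp: W_def)
    have qb: "q \<in> beta X" unfolding *(1) by (rule prod_beta[OF *(3) p(1)])
    have "V \<in> ?m q r'"
      by (rule left_ideal_mem_prod[OF qb *(5) beta_carrier[OF qb] *(6) Vl])
    moreover have "?m q r' \<in> beta X" by (rule prod_beta[OF qb *(5)])
    moreover have "?m q r = ?m (?m q r') p" by (simp add: *(2) prod_assoc)
    ultimately show ?thesis unfolding W_def by blast
  qed
  obtain q0 where "q0 \<in> W" and q0: "?m q0 q0 = q0"
    by (rule idempotent_exists[OF clW Wne Wmult]) (assumption | rule that)+
  then obtain r where r: "q0 = ?m r p" "r \<in> beta X" "V \<in> r" by (auto simp: W_def)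
  have q0p: "?m q0 p = q0" using r pp by (simp add: prod_assoc)
  have q0b: "q0 \<in> beta X" "V \<in> q0"
    unfolding r(1)
    by (rule prod_beta[OF r(2) p(1)], rule right_ideal_mem_prod[OF r(2) p(1) r(3) Vr])
  \<comment> \<open>The factor \<open>p\<close> in front gives absorption on the left as well.
    Idempotency survives because \<open>q0\<close> absorbs the inner \<open>p\<close>.\<close>
  define q where "q = ?m p q0"
  have q: "q \<in> beta X" "V \<in> q"
    unfolding q_def
    by (rule prod_beta[OF p(1) q0b(1)],
        rule left_ideal_mem_prod[OF p(1) q0b(1) beta_carrier[OF p(1)] q0b(2) Vl])
  have pq: "?m p q = q" using pp by (simp add: q_def prod_assoc[symmetric])
  have qp: "?m q p = q" using q0p by (simp add: q_def prod_assoc)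
  have "?m q q = ?m p (?m (?m q0 p) q0)" by (simp add: q_def prod_assoc)
  then have qq: "?m q q = q" using q0p q0 by (simp add: q_def)

  have e_S: "e a x \<in> S" if "a \<in> \<Sigma>" "x \<in> X" for a x
  proof -
    have "e a x = map Some (map (case_option a id) x)" by (simp add: e_def comp_def)
    moreover have "case_option a id y \<in> \<Sigma>" if "y \<in> set x" for y
      using \<open>a \<in> \<Sigma>\<close> \<open>x \<in> X\<close> that unfolding X_def in_lists_conv_set by (cases y) auto
    then have "map (case_option a id) x \<in> lists \<Sigma>" by auto
    ultimately show ?thesis unfolding S_def by (metis imageI)
  qed
  have e_id: "e a x = x" if "x \<in> S" for a x
    using that by (auto simp: e_def S_def comp_def)
  have subst_q: "uf_map X (e a) q = p" if a: "a \<in> \<Sigma>" for a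
  proof -
    have eX: "e a x \<in> X" if "x \<in> X" for x using e_S[OF a that] \<open>S \<subseteq> X\<close> by blast
    have eb: "uf_map X (e a) u \<in> beta X" if "u \<in> beta X" for u
      by (rule uf_map_beta[OF _ that]) (rule eX)
    have hom: "uf_map X (e a) (?m u v) = ?m (uf_map X (e a) u) (uf_map X (e a) v)" for u v
      by (rule uf_map_mult) (auto simp: eX closed, simp add: e_def)
    have "p \<subseteq> uf_map X (e a) p"
    proof
      fix A assume A: "A \<in> p"
      then have "A \<subseteq> X" using beta_sub p by blast
      have "A \<inter> S \<in> p" using beta_Int[OF p(1) A p(2)] .
      then have "{x \<in> X. e a x \<in> A} \<in> p"
        by (rule beta_mono[OF p(1)]) (use \<open>S \<subseteq> X\<close> in \<open>auto simp: e_id\<close>)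
      then show "A \<in> uf_map X (e a) p" using \<open>A \<subseteq> X\<close> by (simp add: uf_map_def)
    qed
    then have ep: "uf_map X (e a) p = p" using beta_eqI[OF p(1) eb[OF p(1)]] by simp
    have "{x \<in> X. e a x \<in> S} = X" using e_S[OF a] by blast
    then have "S \<in> uf_map X (e a) q"
      using beta_carrier[OF q(1)] \<open>S \<subseteq> X\<close> by (simp add: uf_map_def)
    with eb[OF q(1)] have "uf_map X (e a) q \<in> {u \<in> beta X. S \<in> u}" by simp
    then show ?thesis
    proof (rule min)
      show "?m (uf_map X (e a) q) (uf_map X (e a) q) = uf_map X (e a) q" using hom[of q q] qq by simp
      show "?m p (uf_map X (e a) q) = uf_map X (e a) q" using hom[of p q] ep pq by simp
      show "?m (uf_map X (e a) q) p = uf_map X (e a) q" using hom[of q p] ep qp by simp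
    qed
  qed

  \<comment> \<open>The covering sets are transported to constant words in \<open>X\<close>, where
    one of them must belong to \<open>p\<close>, and \<open>p\<close> is the image of
    \<open>q\<close> under every substitution.\<close>
  have "S = \<Union>((\<lambda>C. map Some ` (C \<inter> lists \<Sigma>)) ` \<C>)"
    using assms(3) unfolding S_def by blast
  then have "\<Union>((\<lambda>C. map Some ` (C \<inter> lists \<Sigma>)) ` \<C>) \<in> p" using p(2) by simp
  then obtain C where C: "C \<in> \<C>" "map Some ` (C \<inter> lists \<Sigma>) \<in> p"
    using beta_finite_Union[OF p(1), of "(\<lambda>C. map Some ` (C \<inter> lists \<Sigma>)) ` \<C>"] assms(2) \<open>S \<subseteq> X\<close>
    unfolding S_def by blast
  have "{x \<in> X. e a x \<in> map Some ` (C \<inter> lists \<Sigma>)} \<in> q" if "a \<in> \<Sigma>" for a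
    using C(2) subst_q[OF that] by (auto simp: uf_map_def)
  \<comment> \<open>Finiteness of the alphabet lets a single word serve all letters at once.\<close>
  then have "{x \<in> X. \<forall>a\<in>\<Sigma>. x \<in> {x \<in> X. e a x \<in> map Some ` (C \<inter> lists \<Sigma>)}} \<in> q"
    by (rule beta_finite_INT[OF q(1) assms(1)])
  from beta_nonempty[OF q(1) beta_Int[OF q(1) q(2) this]]
  obtain v where v: "v \<in> V" "\<And>a. a \<in> \<Sigma> \<Longrightarrow> e a v \<in> map Some ` (C \<inter> lists \<Sigma>)" by blast
  have "map (case_option a id) v \<in> C" if "a \<in> \<Sigma>" for a
  proof -
    have "map Some (map (case_option a id) v) \<in> map Some ` (C \<inter> lists \<Sigma>)"
      using v(2)[OF that] by (simp add: e_def comp_def)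
    then obtain u where "u \<in> C" and u: "map Some (map (case_option a id) v) = map Some u" by blast
    have "map (case_option a id) v = u" using u by (simp only: inj_map_eq_map[OF inj_Some])
    then show ?thesis using \<open>u \<in> C\<close> by simp
  qed
  then show ?thesis using v(1) C(1) by (auto simp: V_def X_def)
qed

section \<open>Sums along chains and J-sets\<close>

text \<open>The top set is carried along because it is all that a continuation of the chain has to
  respect.\<close>

inductive chain_sum :: "'b set \<Rightarrow> ('b set \<Rightarrow> 'b \<Rightarrow> nat) \<Rightarrow> 'b set \<Rightarrow> 'b set \<Rightarrow> nat \<Rightarrow> bool"
  for X w F where
  chain_sum_first: "G \<in> Pf X \<Longrightarrow> F \<subset> G \<Longrightarrow> f \<in> G \<Longrightarrow> chain_sum X w F G (w G f)"
| chain_sum_step: "chain_sum X w F U y \<Longrightarrow> G \<in> Pf X \<Longrightarrow> U \<subset> G \<Longrightarrow> f \<in> G \<Longrightarrow>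
    chain_sum X w F G (y + w G f)"

definition chain_sums :: "'b set \<Rightarrow> ('b set \<Rightarrow> 'b \<Rightarrow> nat) \<Rightarrow> 'b set \<Rightarrow> nat set" where
  "chain_sums X w F = {y. \<exists>G. chain_sum X w F G y}"

lemma chain_sum_top: "chain_sum X w F G y \<Longrightarrow> G \<in> Pf X \<and> F \<subset> G"
  by (induction rule: chain_sum.induct) auto

text \<open>Concatenation of chains. This is the source of the semigroup property of the
  ultrafilters containing every \<open>chain_sums X w F\<close>.\<close>

lemma chain_sum_trans:
  assumes "chain_sum X w U G y" "chain_sum X w F U x"
  shows "chain_sum X w F G (x + y)"
  using assms
  by (induction rule: chain_sum.induct) (auto intro: chain_sum_step simp flip: add.assoc)

lemma chain_sum_antimono:
  assumes "chain_sum X w F G y" "F' \<subseteq> F"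
  shows "chain_sum X w F' G y"
  using assms
proof (induction rule: chain_sum.induct)
  case (chain_sum_first G f)
  then show ?case using subset_psubset_trans by (intro chain_sum.chain_sum_first) blast+
next
  case (chain_sum_step U y G f)
  then show ?case by (intro chain_sum.chain_sum_step) blast+
qed

lemma chain_sum_PN:
  assumes "chain_sum X w F G y" "\<And>G f. G \<in> Pf X \<Longrightarrow> f \<in> G \<Longrightarrow> w G f \<in> PN"
  shows "y \<in> PN"
  using assms by (induction rule: chain_sum.induct) (auto simp: PN_def)

lemma chain_sum_sequence:
  assumes "\<And>i. G i \<in> Pf X" "U \<subset> G 0" "\<And>i. G i \<subset> G (Suc i)" "\<And>i. i \<le> n \<Longrightarrow> f i \<in> G i"
  shows "chain_sum X w U (G n) (\<Sum>i\<le>n. w (G i) (f i))"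
  using assms(4)
proof (induction n)
  case 0
  then show ?case using chain_sum_first[OF assms(1,2)] by simp
next
  case (Suc n)
  then have "chain_sum X w U (G n) (\<Sum>i\<le>n. w (G i) (f i))" by simp
  then show ?case using chain_sum_step[OF _ assms(1,3)] Suc.prems by simp
qed

lemma strict_chain_exists:
  assumes "infinite X" "U \<in> Fpow X"
  obtains G :: "nat \<Rightarrow> 'a set" where "\<And>i. G i \<in> Pf X" "U \<subset> G 0" "\<And>i. G i \<subset> G (Suc i)"
proof -
  have grow: "\<exists>G'. (G' \<in> Pf X \<and> U \<subset> G') \<and> G \<subset> G'" if "G \<in> Fpow X" "U \<subseteq> G" for G
  proof -
    have "\<not> X \<subseteq> G" using assms(1) that finite_subset by (auto simp: Fpow_def)
    then obtain x where "x \<in> X" "x \<notin> G" by blast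
    then show ?thesis using that
      by (intro exI[of _ "insert x G"]) (auto simp: Pf_def Fpow_def)
  qed
  have "\<exists>G. \<forall>n. (G n \<in> Pf X \<and> U \<subset> G n) \<and> G n \<subset> G (Suc n)"
  proof (rule dependent_nat_choice)
    show "\<exists>G. G \<in> Pf X \<and> U \<subset> G" using grow[OF assms(2)] by blast
    show "\<exists>G'. (G' \<in> Pf X \<and> U \<subset> G') \<and> G \<subset> G'" if "G \<in> Pf X \<and> U \<subset> G" for G
      using grow[of G] that by (simp add: Pf_def psubset_imp_subset)
  qed
  then obtain G where G: "\<forall>n. (G n \<in> Pf X \<and> U \<subset> G n) \<and> G n \<subset> G (Suc n)" ..
  show thesis by (rule that[of G]) (simp_all add: G)
qed

lemma infinite_PNPN: "infinite PNPN"
proof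
  assume "finite PNPN"
  moreover have "inj (\<lambda>n. \<lambda>i\<in>PN. Suc n)"
    by (rule injI) (auto simp: PN_def dest!: fun_cong[of _ _ 1])
  moreover have "range (\<lambda>n. \<lambda>i\<in>PN. Suc n) \<subseteq> PNPN"
  proof -
    have "Suc n \<in> PN" for n by (simp add: PN_def)
    then show ?thesis by (auto simp: PNPN_def)
  qed
  ultimately show False by (meson finite_imageD finite_subset infinite_UNIV_nat)
qed

definition weight :: "('b set \<Rightarrow> nat) \<Rightarrow> ('b set \<Rightarrow> nat set) \<Rightarrow> 'b set \<Rightarrow> (nat \<Rightarrow> nat) \<Rightarrow> nat" where
  "weight \<alpha> H G f = \<alpha> G + (\<Sum>t\<in>H G. f t)"

section \<open>The ultrafilters consisting of J-sets\<close>

lemma J_setE: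
  assumes "J_set A" "F \<in> Pf PNPN"
  obtains a b where "a \<in> PN" "b \<in> Pf PN" "\<forall>f\<in>F. a + (\<Sum>t\<in>b. f t) \<in> A"
  using assms by (auto simp: J_set_def)

text \<open>The J-set in \<open>p\<close> provides \<open>a\<close> and \<open>b\<close>; the
  finitely many sets in \<open>q\<close> attached to the functions of \<open>F\<close> then share an
  element \<open>y\<close>, which is absorbed into the constant as \<open>a + y\<close>.\<close>

lemma uf_plus_JJ:
  assumes p: "p \<in> JJ" and q: "q \<in> JJ"
  shows "uf_plus p q \<in> JJ"
proof -
  have pb: "p \<in> beta PN" and qb: "q \<in> beta PN" using p q by (auto simp: JJ_def)
  have "uf_plus p q \<in> beta PN"
    unfolding uf_plus_eq_mult by (rule uf_mult_beta[OF _ pb qb]) (auto simp: PN_def)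
  moreover have "J_set A" if A: "A \<in> uf_plus p q" for A
    unfolding J_set_def
  proof (intro conjI ballI)
    show "A \<subseteq> PN" using A by (auto simp: uf_plus_def)
    fix F assume F: "F \<in> Pf PNPN"
    have "J_set {x \<in> PN. {y \<in> PN. x + y \<in> A} \<in> q}"
      using A p by (auto simp: uf_plus_def JJ_def)
    from this F obtain a b where "a \<in> PN" "b \<in> Pf PN"
      and "\<forall>f\<in>F. a + (\<Sum>t\<in>b. f t) \<in> {x \<in> PN. {y \<in> PN. x + y \<in> A} \<in> q}"
      by (rule J_setE)
    then have ab: "a \<in> PN" "b \<in> Pf PN"
      "\<And>f. f \<in> F \<Longrightarrow> {y \<in> PN. a + (\<Sum>t\<in>b. f t) + y \<in> A} \<in> q"
      by auto
    have "finite F" using F by (auto simp: Pf_def Fpow_def)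
    have "{x \<in> PN. \<forall>f\<in>F. x \<in> {y \<in> PN. a + (\<Sum>t\<in>b. f t) + y \<in> A}} \<in> q"
      by (rule beta_finite_INT[OF qb \<open>finite F\<close>]) (rule ab(3))
    from beta_nonempty[OF qb this]
    obtain y where y: "y \<in> PN" "\<And>f. f \<in> F \<Longrightarrow> a + (\<Sum>t\<in>b. f t) + y \<in> A" by blast
    then have "\<forall>f\<in>F. (a + y) + (\<Sum>t\<in>b. f t) \<in> A" by (simp add: ac_simps)
    moreover have "a + y \<in> PN" using ab by (simp add: PN_def)
    ultimately show "\<exists>a\<in>PN. \<exists>b\<in>Pf PN. \<forall>f\<in>F. a + (\<Sum>t\<in>b. f t) \<in> A" using ab(2) by blast
  qed
  ultimately show ?thesis by (simp add: JJ_def)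
qed

lemma closed_JJ: "closed_beta PN JJ"
  by (rule closed_betaI) (auto simp: JJ_def)

lemma chain_sums_cover_J_set:
  assumes \<alpha>: "\<And>G. G \<in> Pf PNPN \<Longrightarrow> \<alpha> G \<in> PN" and H: "\<And>G. G \<in> Pf PNPN \<Longrightarrow> H G \<in> Pf PN"
    and inc: "\<And>F G. F \<in> Pf PNPN \<Longrightarrow> G \<in> Pf PNPN \<Longrightarrow> F \<subset> G \<Longrightarrow> Max (H F) < Min (H G)"
    and "F \<in> Fpow PNPN" "finite \<C>" "\<And>C. C \<in> \<C> \<Longrightarrow> C \<subseteq> PN"
    and cover: "chain_sums PNPN (weight \<alpha> H) F \<subseteq> \<Union>\<C>"
  shows "\<exists>C\<in>\<C>. J_set C"
proof (rule ccontr)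
  assume "\<not> ?thesis"
  then have "\<exists>K. K \<in> Pf PNPN \<and> (\<forall>a\<in>PN. \<forall>b\<in>Pf PN. \<exists>f\<in>K. a + (\<Sum>t\<in>b. f t) \<notin> C)"
    if "C \<in> \<C>" for C
    using that assms(6)[OF that] by (auto simp: J_set_def)
  then obtain K where K: "\<And>C. C \<in> \<C> \<Longrightarrow> K C \<in> Pf PNPN"
    and bad: "\<And>C a b. C \<in> \<C> \<Longrightarrow> a \<in> PN \<Longrightarrow> b \<in> Pf PN \<Longrightarrow> \<exists>f\<in>K C. a + (\<Sum>t\<in>b. f t) \<notin> C"
    by metis
  obtain f0 where f0: "f0 \<in> PNPN" using infinite_PNPN by fastforce
  \<comment> \<open>The alphabet contains every counterexample family \<open>K C\<close>, so that a
    variable word monochromatic over \<open>\<Sigma>\<close> contradicts the choice of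
    \<open>K C\<close>.\<close>
  define \<Sigma> where "\<Sigma> = insert f0 (\<Union>(K ` \<C>))"
  have \<Sigma>: "finite \<Sigma>" "\<Sigma> \<subseteq> PNPN"
    using K f0 assms(5) by (auto simp: \<Sigma>_def Pf_def Fpow_def)
  have "F \<union> \<Sigma> \<in> Fpow PNPN" using \<Sigma> assms(4) by (auto simp: Fpow_def)
  \<comment> \<open>Starting above \<open>\<Sigma>\<close> as well as \<open>F\<close> makes every
    letter available at every position of the chain.\<close>
  then obtain G where G: "\<And>i. G i \<in> Pf PNPN" "F \<union> \<Sigma> \<subset> G 0" "\<And>i. G i \<subset> G (Suc i)"
    using strict_chain_exists[OF infinite_PNPN] by blast
  have less: "G i \<subset> G j" if "i < j" for i j
    using lift_Suc_mono_less[of G i j] G(3) that by blast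
  have \<Sigma>G: "\<Sigma> \<subseteq> G i" for i using G(2) less[of 0 i] by (cases "i = 0") auto
  \<comment> \<open>The extra first letter \<open>f0\<close> is there because a chain sum has at
    least one summand, while the empty word must be coded too.\<close>
  define x where "x u = (\<Sum>i\<le>length u. weight \<alpha> H (G i) ((f0 # u) ! i))" for u
  have "x u \<in> \<Union>\<C>" if u: "u \<in> lists \<Sigma>" for u
  proof -
    have "(f0 # u) ! i \<in> \<Sigma>" if "i \<le> length u" for i
      using that u nth_mem[of i "f0 # u"] by (auto simp: \<Sigma>_def)
    then have "chain_sum PNPN (weight \<alpha> H) F (G (length u)) (x u)"
      unfolding x_def using \<Sigma>G G(2) by (intro chain_sum_sequence G(1,3)) blast+
    then show ?thesis using cover by (auto simp: chain_sums_def)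
  qed
  then have "lists \<Sigma> \<subseteq> \<Union>((\<lambda>C. {u \<in> lists \<Sigma>. x u \<in> C}) ` \<C>)" by blast
  from infinite_Hales_Jewett[OF \<Sigma>(1) _ this] assms(5)
  obtain v C where v: "v \<in> lists (insert None (Some ` \<Sigma>))" "None \<in> set v" and C: "C \<in> \<C>"
    and mono: "\<And>f. f \<in> \<Sigma> \<Longrightarrow> x (map (case_option f id) v) \<in> C"
    by auto
  define n where "n = length v"
  define v' where "v' = Some f0 # v"
  define I where "I = {i \<in> {..n}. v' ! i = None}"
  \<comment> \<open>For a substituted letter \<open>f\<close>, the summands not depending on
    \<open>f\<close> are collected in \<open>a\<close>; the variable positions \<open>I\<close>
    contribute their argument sets to \<open>b\<close>.\<close>
  define a where "a = (\<Sum>i\<le>n. \<alpha> (G i)) + (\<Sum>i\<in>{..n} - I. \<Sum>t\<in>H (G i). the (v' ! i) t)"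
  define b where "b = (\<Union>i\<in>I. H (G i))"
  have HG: "finite (H (G i))" "H (G i) \<noteq> {}" "H (G i) \<subseteq> PN" for i
    using H[OF G(1)[of i]] by (auto simp: Pf_def Fpow_def)
  have "I \<noteq> {}"
  proof -
    obtain i where "i < length v" "v ! i = None" using v(2) by (auto simp: in_set_conv_nth)
    \<comment> \<open>Positions in \<open>v\<close> move up by one behind the prefixed
      \<open>Some f0\<close>.\<close>
    then have "Suc i \<in> I" by (simp add: I_def n_def v'_def)
    then show ?thesis by blast
  qed
  then have "b \<in> Pf PN" using HG by (auto simp: b_def I_def Pf_def Fpow_def)
  have "a \<in> PN"
  proof -
    have "\<alpha> (G 0) \<le> (\<Sum>i\<le>n. \<alpha> (G i))" by (rule member_le_sum) auto
    then show ?thesis using \<alpha>[OF G(1)[of 0]] by (auto simp: a_def PN_def)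
  qed
  \<comment> \<open>This is where the growth condition on \<open>H\<close> enters: the argument sets
    at the variable positions must not overlap if their sums are to merge into one sum over
    \<open>b\<close>.\<close>
  have disj: "H (G i) \<inter> H (G j) = {}" if "i < j" for i j
  proof -
    have lt: "Max (H (G i)) < Min (H (G j))" by (rule inc[OF G(1) G(1) less[OF that]])
    have False if "t \<in> H (G i)" "t \<in> H (G j)" for t
      using Max_ge[OF HG(1) that(1)] Min_le[OF HG(1) that(2)] lt by simp
    then show ?thesis by blast
  qed
  have x_subst: "x (map (case_option f id) v) = a + (\<Sum>t\<in>b. f t)" for f
  proof -
    have letter: "(f0 # map (case_option f id) v) ! i = case_option f id (v' ! i)" if "i \<le> n" for i
      using that by (cases i) (auto simp: v'_def n_def)
    have "x (map (case_option f id) v) = (\<Sum>i\<le>n. weight \<alpha> H (G i) (case_option f id (v' ! i)))"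
      unfolding x_def by (rule sum.cong) (simp_all add: letter n_def)
    also have "\<dots> = (\<Sum>i\<le>n. \<alpha> (G i)) + (\<Sum>i\<le>n. \<Sum>t\<in>H (G i). case_option f id (v' ! i) t)"
      by (simp add: weight_def sum.distrib)
    also have "(\<Sum>i\<le>n. \<Sum>t\<in>H (G i). case_option f id (v' ! i) t) =
        (\<Sum>i\<in>{..n} - I. \<Sum>t\<in>H (G i). case_option f id (v' ! i) t) +
        (\<Sum>i\<in>I. \<Sum>t\<in>H (G i). case_option f id (v' ! i) t)"
      by (rule sum.subset_diff) (auto simp: I_def)
    also have "(\<Sum>i\<in>{..n} - I. \<Sum>t\<in>H (G i). case_option f id (v' ! i) t) =
        (\<Sum>i\<in>{..n} - I. \<Sum>t\<in>H (G i). the (v' ! i) t)"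
      by (rule sum.cong) (auto simp: I_def split: option.splits)
    also have "(\<Sum>i\<in>I. \<Sum>t\<in>H (G i). case_option f id (v' ! i) t) = (\<Sum>i\<in>I. \<Sum>t\<in>H (G i). f t)"
      by (rule sum.cong) (auto simp: I_def)
    also have "\<dots> = (\<Sum>t\<in>b. f t)"
      unfolding b_def
    proof (rule sum.UNION_disjoint[symmetric])
      show "finite I" by (simp add: I_def)
      show "\<forall>i\<in>I. finite (H (G i))" using HG by blast
      show "\<forall>i\<in>I. \<forall>j\<in>I. i \<noteq> j \<longrightarrow> H (G i) \<inter> H (G j) = {}"
        using disj by (metis Int_commute linorder_neqE_nat)
    qed
    finally show ?thesis by (simp add: a_def)
  qed
  obtain f where "f \<in> K C" "a + (\<Sum>t\<in>b. f t) \<notin> C"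
    using bad[OF C \<open>a \<in> PN\<close> \<open>b \<in> Pf PN\<close>] by blast
  moreover from this have "f \<in> \<Sigma>" using C by (auto simp: \<Sigma>_def)
  ultimately show False using mono x_subst by metis
qed

lemma chain_sums_idempotent:
  assumes \<alpha>: "\<And>G. G \<in> Pf PNPN \<Longrightarrow> \<alpha> G \<in> PN" and H: "\<And>G. G \<in> Pf PNPN \<Longrightarrow> H G \<in> Pf PN"
    and inc: "\<And>F G. F \<in> Pf PNPN \<Longrightarrow> G \<in> Pf PNPN \<Longrightarrow> F \<subset> G \<Longrightarrow> Max (H F) < Min (H G)"
  shows "\<exists>p\<in>JJ. uf_idempotent p \<and> (\<forall>F\<in>Fpow PNPN. chain_sums PNPN (weight \<alpha> H) F \<in> p)"
proof -
  let ?T = "chain_sums PNPN (weight \<alpha> H)"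
  interpret carrier_semigroup PN "(+)"
    by unfold_locales (auto simp: PN_def)
  have "weight \<alpha> H G f \<in> PN" if "G \<in> Pf PNPN" for G f
    using \<alpha>[OF that] by (simp add: weight_def PN_def)
  then have T_PN: "?T F \<subseteq> PN" for F using chain_sum_PN by (fastforce simp: chain_sums_def)
  have T_antimono: "?T F \<subseteq> ?T F'" if "F' \<subseteq> F" for F F'
    unfolding chain_sums_def using chain_sum_antimono[OF _ that] by blast
  define Q where "Q = (\<Inter>F\<in>Fpow PNPN. {p \<in> beta PN. ?T F \<in> p})"
  have ne: "{} \<in> Fpow PNPN" by (simp add: Fpow_def)
  have cl: "closed_beta PN (JJ \<inter> Q)"
    unfolding Q_def using closed_beta_basic T_PN ne
    by (intro closed_beta_Int closed_JJ closed_beta_Inter) auto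
  have mult: "uf_mult PN (+) p q \<in> JJ \<inter> Q" if p: "p \<in> JJ \<inter> Q" and q: "q \<in> JJ \<inter> Q" for p q
  proof -
    have J: "uf_mult PN (+) p q \<in> JJ" using uf_plus_JJ p q by (simp add: uf_plus_eq_mult)
    have pb: "p \<in> beta PN" and qb: "q \<in> beta PN" using p q by (auto simp: JJ_def)
    have "?T F \<in> uf_mult PN (+) p q" if F: "F \<in> Fpow PNPN" for F
    proof -
      have "?T F \<subseteq> {x \<in> PN. {y \<in> PN. x + y \<in> ?T F} \<in> q}"
      proof
        fix x assume x: "x \<in> ?T F"
        then obtain G where G: "chain_sum PNPN (weight \<alpha> H) F G x" by (auto simp: chain_sums_def)
        then have "G \<in> Fpow PNPN" using chain_sum_top[OF G] by (simp add: Pf_def)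
        then have "?T G \<in> q" using q by (auto simp: Q_def)
        \<comment> \<open>A chain reaching \<open>x\<close> with top \<open>G\<close> can be
          continued by any chain above \<open>G\<close>, so translation by \<open>x\<close> carries
          \<open>?T G\<close> into \<open>?T F\<close>.\<close>
        moreover have "?T G \<subseteq> {y \<in> PN. x + y \<in> ?T F}"
        proof
          fix y assume y: "y \<in> ?T G"
          then obtain G' where "chain_sum PNPN (weight \<alpha> H) G G' y" by (auto simp: chain_sums_def)
          from chain_sum_trans[OF this G] have "x + y \<in> ?T F" by (auto simp: chain_sums_def)
          then show "y \<in> {y \<in> PN. x + y \<in> ?T F}" using T_PN y by blast
        qed
        ultimately have "{y \<in> PN. x + y \<in> ?T F} \<in> q" by (rule beta_mono[OF qb]) auto
        then show "x \<in> {x \<in> PN. {y \<in> PN. x + y \<in> ?T F} \<in> q}" using T_PN x by auto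
      qed
      moreover have "?T F \<in> p" using p F by (simp add: Q_def)
      ultimately have "{x \<in> PN. {y \<in> PN. x + y \<in> ?T F} \<in> q} \<in> p"
        using beta_mono[OF pb] by blast
      then show ?thesis using T_PN by (simp add: uf_mult_def)
    qed
    then show ?thesis using J prod_beta[OF pb qb] by (simp add: Q_def)
  qed
  \<comment> \<open>Containing the complement of every non-J-set is the same as having only J-sets
    as members, so the ultrafilters above this family are exactly
    \<open>JJ \<inter> Q\<close>.\<close>
  let ?\<F> = "?T ` Fpow PNPN \<union> (\<lambda>C. PN - C) ` {C. C \<subseteq> PN \<and> \<not> J_set C}"
  have "\<exists>u\<in>beta PN. ?\<F> \<subseteq> u"
  proof (rule ultrafilter_extension)
    show "?\<F> \<subseteq> Pow PN" using T_PN by auto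
    fix \<G> assume \<G>: "finite \<G>" "\<G> \<subseteq> ?\<F>"
    show "PN \<inter> \<Inter>\<G> \<noteq> {}"
    proof
      assume empty: "PN \<inter> \<Inter>\<G> = {}"
      have "finite (\<G> \<inter> ?T ` Fpow PNPN)" "\<G> \<inter> ?T ` Fpow PNPN \<subseteq> ?T ` Fpow PNPN" using \<G> by auto
      then obtain \<K> where \<K>: "finite \<K>" "\<K> \<subseteq> Fpow PNPN" "\<G> \<inter> ?T ` Fpow PNPN = ?T ` \<K>"
        by (meson finite_subset_image)
      \<comment> \<open>Complements of sets \<open>?T F\<close> that happen not to be J-sets may
        slip in as well; only finiteness and the failure of the J-set property matter.\<close>
      define \<C> where "\<C> = {C \<in> (\<lambda>A. PN - A) ` \<G>. C \<subseteq> PN \<and> \<not> J_set C}"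
      \<comment> \<open>By antimonotonicity the finitely many sets \<open>?T F\<close> in
        \<open>\<G>\<close> are all bounded below by the single set
        \<open>?T (\<Union>\<K>)\<close>.\<close>
      have "\<Union>\<K> \<in> Fpow PNPN" using \<K>(1,2) by (auto simp: Fpow_def)
      moreover have "finite \<C>" using \<G> by (simp add: \<C>_def)
      moreover have "?T (\<Union>\<K>) \<subseteq> \<Union>\<C>"
      proof
        fix y assume y: "y \<in> ?T (\<Union>\<K>)"
        then have "y \<in> PN" using T_PN by blast
        then obtain A where A: "A \<in> \<G>" "y \<notin> A" using empty by blast
        have "y \<in> ?T F" if "F \<in> \<K>" for F
          using y T_antimono[OF Union_upper[OF that]] by blast
        then have "A \<notin> ?T ` \<K>" using A(2) by blast
        then have "A \<in> (\<lambda>C. PN - C) ` {C. C \<subseteq> PN \<and> \<not> J_set C}" using A(1) \<G>(2) \<K>(3) by blast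
        then have "PN - A \<in> \<C>" using A(1) by (auto simp: \<C>_def double_diff)
        then show "y \<in> \<Union>\<C>" using \<open>y \<in> PN\<close> A(2) by blast
      qed
      ultimately have "\<exists>C\<in>\<C>. J_set C"
        by (intro chain_sums_cover_J_set[OF \<alpha> H inc]) (auto simp: \<C>_def)
      then show False by (auto simp: \<C>_def)
    qed
  qed
  then obtain u where u: "u \<in> beta PN" "?\<F> \<subseteq> u" by blast
  have "J_set A" if A: "A \<in> u" for A
  proof (rule ccontr)
    assume "\<not> J_set A"
    then have "PN - A \<in> u" using u(2) beta_sub[OF u(1) A] by blast
    then show False using beta_compl[OF u(1) beta_sub[OF u(1) A]] A by simp
  qed
  then have "u \<in> JJ \<inter> Q" using u by (auto simp: JJ_def Q_def)
  then have "JJ \<inter> Q \<noteq> {}" by blast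
  from idempotent_exists[OF cl this mult]
  obtain p where "p \<in> JJ \<inter> Q" "uf_mult PN (+) p p = p" .
  then show ?thesis by (auto simp: uf_idempotent_def uf_plus_eq_mult Q_def)
qed

section \<open>Tuples of chain sums and tensor products\<close>

lemma PNpow_0: "PNpow 0 = {\<lambda>_. undefined}"
  by (simp add: PNpow_def)

lemma PNpow_upd: "s \<in> PNpow k \<Longrightarrow> y \<in> PN \<Longrightarrow> s(Suc k := y) \<in> PNpow (Suc k)"
  by (auto simp: PNpow_def PiE_iff extensional_def)

text \<open>Brings the base case into the form of the recursive step, with the everywhere undefined
  function as empty tuple.\<close>

lemma tensor_1:
  "A \<in> tensor p (Suc 0) \<longleftrightarrow>
    A \<subseteq> PNpow 1 \<and> {y \<in> PN. (\<lambda>_. undefined)(Suc 0 := y) \<in> A} \<in> p 1"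
proof -
  have "(\<lambda>i\<in>{1}. y) = (\<lambda>_. undefined)(Suc 0 := y)" for y :: nat
    by (auto simp: fun_eq_iff)
  then show ?thesis by simp
qed

lemma tensor_mono:
  assumes "\<And>j. j \<in> {1..Suc k} \<Longrightarrow> p j \<in> beta PN"
    and "A \<in> tensor p (Suc k)" "A \<subseteq> B" "B \<subseteq> PNpow (Suc k)"
  shows "B \<in> tensor p (Suc k)"
  using assms
proof (induction k arbitrary: A B)
  case 0
  have "{y \<in> PN. (\<lambda>_. undefined)(Suc 0 := y) \<in> B} \<in> p 1"
  proof (rule beta_mono)
    show "p 1 \<in> beta PN" using 0 by simp
    show "{y \<in> PN. (\<lambda>_. undefined)(Suc 0 := y) \<in> A} \<in> p 1"
      using 0(2) unfolding tensor_1 by blast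
  qed (use 0 in auto)
  then show ?case using 0 unfolding tensor_1 by simp
next
  case (Suc k)
  let ?S = "\<lambda>A x. {y \<in> PN. x(Suc (Suc k) := y) \<in> A}"
  have p: "p (Suc (Suc k)) \<in> beta PN" using Suc.prems(1) by simp
  have "?S B x \<in> p (Suc (Suc k))" if "?S A x \<in> p (Suc (Suc k))" for x
    by (rule beta_mono[OF p that]) (use Suc.prems(3) in auto)
  then have "{x \<in> PNpow (Suc k). ?S A x \<in> p (Suc (Suc k))}
      \<subseteq> {x \<in> PNpow (Suc k). ?S B x \<in> p (Suc (Suc k))}" by blast
  moreover have "{x \<in> PNpow (Suc k). ?S A x \<in> p (Suc (Suc k))} \<in> tensor p (Suc k)"
    using Suc.prems(2) by simp
  ultimately have "{x \<in> PNpow (Suc k). ?S B x \<in> p (Suc (Suc k))} \<in> tensor p (Suc k)"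
    using Suc.IH[of "{x \<in> PNpow (Suc k). ?S A x \<in> p (Suc (Suc k))}"] Suc.prems(1) by simp
  then show ?case using Suc.prems(4) by simp
qed

text \<open>\<open>tensor\<close> peels entries off the end; the sets \<open>D i\<close> make it
  possible to build a tuple from the empty one, entry by entry, without leaving the region from
  which \<open>A\<close> can still be reached.\<close>

lemma tensor_sections:
  assumes "A \<in> tensor p (Suc k)"
  shows "\<exists>D. D (Suc k) = A \<and> (\<lambda>_. undefined) \<in> D 0 \<and>
    (\<forall>i\<le>k. \<forall>x\<in>D i. {y \<in> PN. x(Suc i := y) \<in> D (Suc i)} \<in> p (Suc i))"
  using assms
proof (induction k arbitrary: A)
  case 0
  then show ?case
    unfolding tensor_1 by (intro exI[of _ "\<lambda>i. if i = 0 then {\<lambda>_. undefined} else A"])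
      (simp add: fun_upd_def)
next
  case (Suc k)
  let ?A = "{x \<in> PNpow (Suc k). {y \<in> PN. x(Suc (Suc k) := y) \<in> A} \<in> p (Suc (Suc k))}"
  have "?A \<in> tensor p (Suc k)" using Suc.prems by simp
  from Suc.IH[OF this] obtain D where D: "D (Suc k) = ?A" "(\<lambda>_. undefined) \<in> D 0"
    "\<And>i x. i \<le> k \<Longrightarrow> x \<in> D i \<Longrightarrow> {y \<in> PN. x(Suc i := y) \<in> D (Suc i)} \<in> p (Suc i)" by blast
  define D' where "D' = D(Suc (Suc k) := A)"
  have "\<forall>i\<le>Suc k. \<forall>x\<in>D' i. {y \<in> PN. x(Suc i := y) \<in> D' (Suc i)} \<in> p (Suc i)"
  proof (intro allI impI ballI)
    fix i x assume "i \<le> Suc k" "x \<in> D' i"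
    then show "{y \<in> PN. x(Suc i := y) \<in> D' (Suc i)} \<in> p (Suc i)"
      using D(3)[of i x] D(1) by (cases "i = Suc k") (auto simp: D'_def)
  qed
  moreover have "D' (Suc (Suc k)) = A" "(\<lambda>_. undefined) \<in> D' 0" using D(2) by (auto simp: D'_def)
  ultimately show ?case by blast
qed

text \<open>The partial tuples of (1): the next set of the chain either joins the current block
  \<open>k\<close> or opens block \<open>Suc k\<close>. Gaps in the index sets of (1) are covered,
  since a subsequence of a strict chain is a strict chain.\<close>

inductive reach :: "'b set \<Rightarrow> (nat \<Rightarrow> 'b set \<Rightarrow> 'b \<Rightarrow> nat) \<Rightarrow> 'b set \<Rightarrow> nat \<Rightarrow> (nat \<Rightarrow> nat) \<Rightarrow> bool"
  for X w where
  reach_empty: "reach X w {} 0 (\<lambda>_. undefined)"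
| reach_same: "reach X w U k s \<Longrightarrow> 0 < k \<Longrightarrow> G \<in> Pf X \<Longrightarrow> U \<subset> G \<Longrightarrow> f \<in> G \<Longrightarrow>
    reach X w G k (s(k := s k + w k G f))"
| reach_next: "reach X w U k s \<Longrightarrow> G \<in> Pf X \<Longrightarrow> U \<subset> G \<Longrightarrow> f \<in> G \<Longrightarrow>
    reach X w G (Suc k) (s(Suc k := w (Suc k) G f))"

lemma reach_top: "reach X w U k s \<Longrightarrow> U \<in> Fpow X"
  by (induction rule: reach.induct) (simp_all add: Pf_def empty_in_Fpow)

text \<open>Sets only grow along a derivation, so one that ends in \<open>U\<close> consults no
  weight outside the subsets of \<open>U\<close>. The recursive choice of the weights rests on this
  locality.\<close>

lemma reach_cong:
  assumes "reach X w U k s" "\<forall>j V f. V \<subseteq> U \<longrightarrow> w j V f = w' j V f"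
  shows "reach X w' U k s"
  using assms
proof (induction rule: reach.induct)
  case reach_empty
  show ?case by (rule reach.reach_empty)
next
  case (reach_same U k s G f)
  have "reach X w' U k s"
    by (rule reach_same.IH) (use reach_same.prems reach_same.hyps(4) in blast)
  note reach.reach_same[OF this reach_same.hyps(2-5)]
  moreover have "w k G f = w' k G f" using reach_same.prems by simp
  ultimately show ?case by (simp only:)
next
  case (reach_next U k s G f)
  have "reach X w' U k s"
    by (rule reach_next.IH) (use reach_next.prems reach_next.hyps(3) in blast)
  note reach.reach_next[OF this reach_next.hyps(2-4)]
  moreover have "w (Suc k) G f = w' (Suc k) G f" using reach_next.prems by simp
  ultimately show ?case by (simp only:)
qed

text \<open>Inverting the last step leaves a state at a proper subset of \<open>U\<close> and a
  function in \<open>U\<close>; both range over finite sets.\<close>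

lemma finite_reach_at:
  assumes "finite U"
  shows "finite {(k, s). reach X w U k s}"
  using assms
proof (induction rule: finite_psubset_induct)
  case (psubset U)
  define R where "R = (\<Union>V\<in>{V. V \<subset> U}. {(k, s). reach X w V k s})"
  have "finite {V. V \<subset> U}" using psubset(1) by (auto intro: finite_subset[of _ "Pow U"])
  then have "finite R" unfolding R_def using psubset(2) by blast
  let ?same = "\<lambda>((k, s), f). (k, s(k := s k + w k U f))"
  let ?next = "\<lambda>((k, s), f). (Suc k, s(Suc k := w (Suc k) U f))"
  have "{(k, s). reach X w U k s} \<subseteq>
      insert (0, \<lambda>_. undefined) (?same ` (R \<times> U) \<union> ?next ` (R \<times> U))"
  proof
    fix x assume "x \<in> {(k, s). reach X w U k s}"
    then obtain k s where x: "x = (k, s)" and "reach X w U k s" by blast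
    from this(2) show "x \<in> insert (0, \<lambda>_. undefined) (?same ` (R \<times> U) \<union> ?next ` (R \<times> U))"
    proof cases
      case (reach_same V s' f)
      then have "((k, s'), f) \<in> R \<times> U" by (auto simp: R_def)
      from imageI[OF this, of ?same] show ?thesis using x reach_same by simp
    next
      case (reach_next V k' s' f)
      then have "((k', s'), f) \<in> R \<times> U" by (auto simp: R_def)
      from imageI[OF this, of ?next] show ?thesis using x reach_next by simp
    qed (simp add: x)
  qed
  then show ?case by (rule finite_subset) (simp add: \<open>finite R\<close> psubset(1))
qed

lemma finite_reach_below:
  assumes "finite F"
  shows "finite {(k, s). \<exists>U. U \<subset> F \<and> reach X w U k s}"
proof -
  have "{(k, s). \<exists>U. U \<subset> F \<and> reach X w U k s} \<subseteq> (\<Union>U\<in>Pow F. {(k, s). reach X w U k s})" by blast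
  moreover have "finite (\<Union>U\<in>Pow F. {(k, s). reach X w U k s})"
  proof (rule finite_UN_I)
    show "finite (Pow F)" using assms by simp
    show "finite {(k, s). reach X w U k s}" if "U \<in> Pow F" for U
      using that assms by (intro finite_reach_at) (auto intro: finite_subset)
  qed
  ultimately show ?thesis by (rule finite_subset)
qed

lemma reach_chain_sum:
  assumes "chain_sum X (w (Suc k)) U G y" "reach X w U k s"
  shows "reach X w G (Suc k) (s(Suc k := y))"
  using assms
proof (induction rule: chain_sum.induct)
  case (chain_sum_first G f)
  then show ?case by (intro reach_next)
next
  case (chain_sum_step V y G f)
  from reach_same[OF chain_sum_step.IH[OF chain_sum_step.prems] _ chain_sum_step.hyps(2-4)]
  show ?case by (simp only: fun_upd_upd fun_upd_same zero_less_Suc simp_thms)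
qed

text \<open>Every sum above the top of a reachable tuple is a legal next entry, and those sums form
  a member of the next ultrafilter; iterating this is membership in the tensor product.\<close>

lemma reach_tensor:
  assumes p: "\<And>j. j \<in> {1..m} \<Longrightarrow> p j \<in> beta PN"
    and sums: "\<And>j F. j \<in> {1..m} \<Longrightarrow> F \<in> Fpow X \<Longrightarrow> chain_sums X (w j) F \<in> p j"
    and w: "\<And>j G f. j \<in> {1..m} \<Longrightarrow> G \<in> Pf X \<Longrightarrow> f \<in> G \<Longrightarrow> w j G f \<in> PN"
    and "Suc k \<le> m"
  shows "{s \<in> PNpow (Suc k). \<exists>U. reach X w U (Suc k) s} \<in> tensor p (Suc k)"
proof -
  define B where "B k = {s \<in> PNpow k. \<exists>U. reach X w U k s}" for k
  have sect: "{y \<in> PN. s(Suc k := y) \<in> B (Suc k)} \<in> p (Suc k)" if s: "s \<in> B k" and k: "Suc k \<le> m" for s k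
  proof -
    obtain U where U: "reach X w U k s" using s by (auto simp: B_def)
    have j: "Suc k \<in> {1..m}" using k by simp
    show ?thesis
    proof (rule beta_mono[OF p[OF j] sums[OF j reach_top[OF U]]])
      show "chain_sums X (w (Suc k)) U \<subseteq> {y \<in> PN. s(Suc k := y) \<in> B (Suc k)}"
      proof
        fix y assume "y \<in> chain_sums X (w (Suc k)) U"
        then obtain G where G: "chain_sum X (w (Suc k)) U G y" by (auto simp: chain_sums_def)
        have "y \<in> PN" using chain_sum_PN[OF G w[OF j]] .
        moreover from this have "s(Suc k := y) \<in> PNpow (Suc k)"
          using s PNpow_upd by (simp add: B_def)
        moreover have "reach X w G (Suc k) (s(Suc k := y))" by (rule reach_chain_sum[where w = w, OF G U])
        ultimately show "y \<in> {y \<in> PN. s(Suc k := y) \<in> B (Suc k)}" by (auto simp: B_def)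
      qed
    qed blast
  qed
  have "B (Suc k) \<in> tensor p (Suc k)"
    using assms(4)
  proof (induction k)
    case 0
    have "(\<lambda>_. undefined) \<in> B 0" using reach_empty by (auto simp: B_def PNpow_0)
    from sect[OF this] 0 have "{y \<in> PN. (\<lambda>_. undefined)(Suc 0 := y) \<in> B (Suc 0)} \<in> p 1" by simp
    then show ?case unfolding tensor_1 by (auto simp: B_def)
  next
    case (Suc k)
    have "B (Suc k) \<subseteq> PNpow (Suc k)" by (auto simp: B_def)
    have "{s \<in> PNpow (Suc k). {y \<in> PN. s(Suc (Suc k) := y) \<in> B (Suc (Suc k))} \<in> p (Suc (Suc k))}
        \<in> tensor p (Suc k)"
    proof (rule tensor_mono)
      show "B (Suc k) \<in> tensor p (Suc k)" using Suc by simp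
      show "B (Suc k) \<subseteq> {s \<in> PNpow (Suc k).
          {y \<in> PN. s(Suc (Suc k) := y) \<in> B (Suc (Suc k))} \<in> p (Suc (Suc k))}"
        using sect[of _ "Suc k"] Suc.prems \<open>B (Suc k) \<subseteq> PNpow (Suc k)\<close> by blast
    qed (use p Suc.prems in auto)
    then show ?case by (auto simp: B_def)
  qed
  then show ?thesis by (simp add: B_def)
qed

text \<open>Each rule application adds one index: \<open>reach_same\<close> inserts it into the
  current block, \<open>reach_next\<close> makes it a singleton block. For \<open>n = 0\<close>
  there is no last set, hence the case distinction for \<open>U\<close>.\<close>

lemma reach_sequence:
  assumes "reach X w U k s"
  shows "\<exists>n G f \<beta>. (\<forall>i\<in>{1..n}. G i \<in> Pf X \<and> f i \<in> G i) \<and> (\<forall>i\<in>{1..<n}. G i \<subset> G (Suc i)) \<and>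
    U = (if n = 0 then {} else G n) \<and>
    (\<forall>j\<in>{1..k}. \<beta> j \<subseteq> {1..n} \<and> \<beta> j \<noteq> {} \<and> s j = (\<Sum>i\<in>\<beta> j. w j (G i) (f i))) \<and>
    (\<forall>j\<in>{1..<k}. \<forall>a\<in>\<beta> j. \<forall>b\<in>\<beta> (Suc j). a < b)"
  using assms
proof (induction rule: reach.induct)
  case reach_empty
  show ?case by (rule exI[of _ 0]) simp
next
  case (reach_same U k s G' f')
  from reach_same.IH obtain n G f \<beta> where IH0:
    "\<forall>i\<in>{1..n}. G i \<in> Pf X \<and> f i \<in> G i" "\<forall>i\<in>{1..<n}. G i \<subset> G (Suc i)"
    "U = (if n = 0 then {} else G n)"
    "\<forall>j\<in>{1..k}. \<beta> j \<subseteq> {1..n} \<and> \<beta> j \<noteq> {} \<and> s j = (\<Sum>i\<in>\<beta> j. w j (G i) (f i))"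
    "\<forall>j\<in>{1..<k}. \<forall>a\<in>\<beta> j. \<forall>b\<in>\<beta> (Suc j). a < b"
    by (elim exE conjE) (rule that)
  note IH = IH0[rule_format]
  define G1 where "G1 = G(Suc n := G')"
  define f1 where "f1 = f(Suc n := f')"
  define \<beta>1 where "\<beta>1 = \<beta>(k := insert (Suc n) (\<beta> k))"
  have 1: "\<forall>i\<in>{1..Suc n}. G1 i \<in> Pf X \<and> f1 i \<in> G1 i"
    using IH(1) reach_same by (auto simp: G1_def f1_def)
  have 2: "\<forall>i\<in>{1..<Suc n}. G1 i \<subset> G1 (Suc i)"
  proof
    fix i assume "i \<in> {1..<Suc n}"
    then show "G1 i \<subset> G1 (Suc i)"
      using IH(2)[of i] IH(3) reach_same.hyps(4) by (cases "i = n") (simp_all add: G1_def)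
  qed
  have sum: "(\<Sum>i\<in>\<beta> j. w j (G1 i) (f1 i)) = (\<Sum>i\<in>\<beta> j. w j (G i) (f i))" if "j \<in> {1..k}" for j
    by (rule sum.cong) (use IH(4)[OF that] in \<open>auto simp: G1_def f1_def\<close>)
  have k: "k \<in> {1..k}" using reach_same.hyps(2) by simp
  have "Suc n \<notin> \<beta> k" "finite (\<beta> k)" using IH(4)[OF k] finite_subset by auto
  then have sumk: "(\<Sum>i\<in>\<beta>1 k. w k (G1 i) (f1 i)) = s k + w k G' f'"
    using IH(4)[OF k] sum[OF k] by (simp add: \<beta>1_def G1_def f1_def)
  have 3: "\<forall>j\<in>{1..k}. \<beta>1 j \<subseteq> {1..Suc n} \<and> \<beta>1 j \<noteq> {} \<and>
      (s(k := s k + w k G' f')) j = (\<Sum>i\<in>\<beta>1 j. w j (G1 i) (f1 i))"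
  proof
    fix j assume j: "j \<in> {1..k}"
    show "\<beta>1 j \<subseteq> {1..Suc n} \<and> \<beta>1 j \<noteq> {} \<and>
      (s(k := s k + w k G' f')) j = (\<Sum>i\<in>\<beta>1 j. w j (G1 i) (f1 i))"
    proof (cases "j = k")
      case True
      then show ?thesis using sumk IH(4)[OF j] by (auto simp: \<beta>1_def)
    next
      case False
      then show ?thesis using sum[OF j] IH(4)[OF j] by (auto simp: \<beta>1_def)
    qed
  qed
  have 4: "\<forall>j\<in>{1..<k}. \<forall>a\<in>\<beta>1 j. \<forall>b\<in>\<beta>1 (Suc j). a < b"
  proof (intro ballI)
    fix j a b assume j: "j \<in> {1..<k}" and a: "a \<in> \<beta>1 j" and b: "b \<in> \<beta>1 (Suc j)"
    have a': "a \<in> \<beta> j" using a j by (simp add: \<beta>1_def)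
    then have "a < Suc n" using IH(4)[of j] j by auto
    then show "a < b" using IH(5)[OF j a'] b by (auto simp: \<beta>1_def split: if_splits)
  qed
  show ?case
    by (rule exI[of _ "Suc n"], rule exI[of _ G1], rule exI[of _ f1], rule exI[of _ \<beta>1])
      (use 1 2 3 4 in \<open>simp add: G1_def\<close>)
next
  case (reach_next U k s G' f')
  from reach_next.IH obtain n G f \<beta> where IH0:
    "\<forall>i\<in>{1..n}. G i \<in> Pf X \<and> f i \<in> G i" "\<forall>i\<in>{1..<n}. G i \<subset> G (Suc i)"
    "U = (if n = 0 then {} else G n)"
    "\<forall>j\<in>{1..k}. \<beta> j \<subseteq> {1..n} \<and> \<beta> j \<noteq> {} \<and> s j = (\<Sum>i\<in>\<beta> j. w j (G i) (f i))"
    "\<forall>j\<in>{1..<k}. \<forall>a\<in>\<beta> j. \<forall>b\<in>\<beta> (Suc j). a < b"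
    by (elim exE conjE) (rule that)
  note IH = IH0[rule_format]
  define G1 where "G1 = G(Suc n := G')"
  define f1 where "f1 = f(Suc n := f')"
  define \<beta>1 where "\<beta>1 = \<beta>(Suc k := {Suc n})"
  have 1: "\<forall>i\<in>{1..Suc n}. G1 i \<in> Pf X \<and> f1 i \<in> G1 i"
    using IH(1) reach_next by (auto simp: G1_def f1_def)
  have 2: "\<forall>i\<in>{1..<Suc n}. G1 i \<subset> G1 (Suc i)"
  proof
    fix i assume "i \<in> {1..<Suc n}"
    then show "G1 i \<subset> G1 (Suc i)"
      using IH(2)[of i] IH(3) reach_next.hyps(3) by (cases "i = n") (simp_all add: G1_def)
  qed
  have sum: "(\<Sum>i\<in>\<beta> j. w j (G1 i) (f1 i)) = (\<Sum>i\<in>\<beta> j. w j (G i) (f i))" if "j \<in> {1..k}" for j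
    by (rule sum.cong) (use IH(4)[OF that] in \<open>auto simp: G1_def f1_def\<close>)
  have 3: "\<forall>j\<in>{1..Suc k}. \<beta>1 j \<subseteq> {1..Suc n} \<and> \<beta>1 j \<noteq> {} \<and>
      (s(Suc k := w (Suc k) G' f')) j = (\<Sum>i\<in>\<beta>1 j. w j (G1 i) (f1 i))"
  proof
    fix j assume j: "j \<in> {1..Suc k}"
    show "\<beta>1 j \<subseteq> {1..Suc n} \<and> \<beta>1 j \<noteq> {} \<and>
      (s(Suc k := w (Suc k) G' f')) j = (\<Sum>i\<in>\<beta>1 j. w j (G1 i) (f1 i))"
    proof (cases "j = Suc k")
      case True
      then show ?thesis by (simp add: \<beta>1_def G1_def f1_def)
    next
      case False
      then have "j \<in> {1..k}" using j by simp
      then show ?thesis using sum[of j] IH(4)[of j] False by (auto simp: \<beta>1_def)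
    qed
  qed
  have 4: "\<forall>j\<in>{1..<Suc k}. \<forall>a\<in>\<beta>1 j. \<forall>b\<in>\<beta>1 (Suc j). a < b"
  proof (intro ballI)
    fix j a b assume j: "j \<in> {1..<Suc k}" and a: "a \<in> \<beta>1 j" and b: "b \<in> \<beta>1 (Suc j)"
    have a': "a \<in> \<beta> j" using a j by (simp add: \<beta>1_def)
    then have "a < Suc n" using IH(4)[of j] j by auto
    then show "a < b" using IH(5)[of j a b] j a' b by (auto simp: \<beta>1_def split: if_splits)
  qed
  show ?case
    by (rule exI[of _ "Suc n"], rule exI[of _ G1], rule exI[of _ f1], rule exI[of _ \<beta>1])
      (use 1 2 3 4 in \<open>simp add: G1_def\<close>)
qed

section \<open>Sequences as in condition (1) and their reachable tuples\<close>

lemma sequence_strict_mono: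
  fixes G :: "nat \<Rightarrow> 'a set"
  assumes "\<And>i. i \<in> PN \<Longrightarrow> G i \<subset> G (i + 1)" "i \<in> PN" "i < j"
  shows "G i \<subset> G j"
proof -
  have "G (Suc (i - 1)) \<subset> G (Suc (j - 1))"
    by (rule lift_Suc_mono_less[of "\<lambda>i. G (Suc i)"]) (use assms in \<open>auto simp: PN_def\<close>)
  then show ?thesis using assms(2,3) by (simp add: PN_def)
qed

text \<open>Induction on the largest index; indices missing from \<open>b\<close> are bridged by
  strict monotonicity of \<open>G\<close>.\<close>

lemma sequence_chain_sum:
  assumes G: "\<And>i. i \<in> PN \<Longrightarrow> G i \<in> Pf X" "\<And>i. i \<in> PN \<Longrightarrow> G i \<subset> G (i + 1)"
    and f: "\<And>i. i \<in> PN \<Longrightarrow> f i \<in> G i"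
    and "b \<in> Pf PN" "F \<subset> G (Min b)"
  shows "chain_sum X w F (G (Max b)) (\<Sum>i\<in>b. w (G i) (f i))"
proof -
  have "finite b" "b \<noteq> {}" "b \<subseteq> PN" using assms(4) by (auto simp: Pf_def Fpow_def)
  then show ?thesis using assms(5)
  proof (induction rule: finite_linorder_max_induct)
    case (insert n b)
    have n: "n \<in> PN" using insert.prems by simp
    show ?case
    proof (cases "b = {}")
      case True
      then show ?thesis using insert.prems G(1)[OF n] f[OF n] chain_sum_first by simp
    next
      case False
      then have "Max b \<in> b" "Min b \<in> b" using insert(1) by simp_all
      then have "Max b < n" "Min b < n" using insert(2) by blast+
      have "Max b \<in> PN" using \<open>Max b \<in> b\<close> insert.prems(2) by blast
      have "Min (insert n b) = Min b"
        using insert(1) \<open>Min b < n\<close> False by (metis Min_insert less_imp_le min.absorb2)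
      moreover have "Max (insert n b) = n"
        using insert(1) \<open>Max b < n\<close> False by (metis Max_insert less_imp_le max.absorb1)
      moreover have "n \<notin> b" using insert(2) by blast
      moreover have "chain_sum X w F (G (Max b)) (\<Sum>i\<in>b. w (G i) (f i))"
        using insert calculation False by simp
      from chain_sum_step[OF this G(1)[OF n] sequence_strict_mono[where G = G, OF G(2) \<open>Max b \<in> PN\<close> \<open>Max b < n\<close>] f[OF n]]
      have "chain_sum X w F (G n) ((\<Sum>i\<in>b. w (G i) (f i)) + w (G n) (f n))" .
      ultimately show ?thesis using insert(1) by (simp add: add.commute)
    qed
  qed simp
qed

text \<open>The return direction to \<open>reach_sequence\<close>. The order of the blocks puts the
  top of block \<open>k\<close> strictly below the first set of block \<open>Suc k\<close>.\<close>

lemma sequence_reach: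
  assumes G: "\<And>i. i \<in> PN \<Longrightarrow> G i \<in> Pf X" "\<And>i. i \<in> PN \<Longrightarrow> G i \<subset> G (i + 1)"
    and f: "\<And>i. i \<in> PN \<Longrightarrow> f i \<in> G i"
    and \<beta>: "\<And>j. j \<in> {1..m} \<Longrightarrow> \<beta> j \<in> Pf PN"
      "\<And>j. j \<in> {1..<m} \<Longrightarrow> Max (\<beta> j) < Min (\<beta> (j + 1))"
    and "k \<le> m"
  shows "reach X w (if k = 0 then {} else G (Max (\<beta> k))) k
    (\<lambda>j\<in>{1..k}. \<Sum>i\<in>\<beta> j. w j (G i) (f i))"
  using assms(6)
proof (induction k)
  case 0
  then show ?case using reach_empty by simp
next
  case (Suc k)
  have \<beta>_PN: "Max (\<beta> j) \<in> PN" "Min (\<beta> j) \<in> PN" if "j \<in> {1..m}" for j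
  proof -
    have "finite (\<beta> j)" "\<beta> j \<noteq> {}" "\<beta> j \<subseteq> PN" using \<beta>(1)[OF that] by (auto simp: Pf_def Fpow_def)
    then show "Max (\<beta> j) \<in> PN" "Min (\<beta> j) \<in> PN" using Max_in Min_in by blast+
  qed
  have j: "Suc k \<in> {1..m}" using Suc.prems by simp
  have "(if k = 0 then {} else G (Max (\<beta> k))) \<subset> G (Min (\<beta> (Suc k)))"
  proof (cases "k = 0")
    case True
    then show ?thesis using G(1)[OF \<beta>_PN(2)[OF j]] by (auto simp: Pf_def)
  next
    case False
    then have "k \<in> {1..<m}" using Suc.prems by simp
    then show ?thesis
      using sequence_strict_mono[where G = G, OF G(2)] \<beta>_PN(1)[of k] \<beta>(2)[of k] by simp
  qed
  from sequence_chain_sum[where G = G and w = "w (Suc k)", OF G f \<beta>(1)[OF j] this]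
  have *: "chain_sum X (w (Suc k)) (if k = 0 then {} else G (Max (\<beta> k))) (G (Max (\<beta> (Suc k))))
      (\<Sum>i\<in>\<beta> (Suc k). w (Suc k) (G i) (f i))" .
  have "reach X w (if k = 0 then {} else G (Max (\<beta> k))) k
      (\<lambda>j\<in>{1..k}. \<Sum>i\<in>\<beta> j. w j (G i) (f i))"
    by (rule Suc.IH) (use Suc.prems in simp)
  from reach_chain_sum[where w = w, OF * this]
  have "reach X w (G (Max (\<beta> (Suc k)))) (Suc k)
    ((\<lambda>j\<in>{1..k}. \<Sum>i\<in>\<beta> j. w j (G i) (f i))(Suc k := \<Sum>i\<in>\<beta> (Suc k). w (Suc k) (G i) (f i)))" .
  moreover have "(\<lambda>j\<in>{1..k}. \<Sum>i\<in>\<beta> j. w j (G i) (f i))(Suc k := \<Sum>i\<in>\<beta> (Suc k). w (Suc k) (G i) (f i))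
      = (\<lambda>j\<in>{1..Suc k}. \<Sum>i\<in>\<beta> j. w j (G i) (f i))"
    by (auto simp: fun_eq_iff)
  ultimately have "reach X w (G (Max (\<beta> (Suc k)))) (Suc k)
    (\<lambda>j\<in>{1..Suc k}. \<Sum>i\<in>\<beta> j. w j (G i) (f i))"
    by (simp only:)
  then show ?case by (simp only: nat.distinct if_False)
qed

section \<open>Chain sums inside a member of a tensor product\<close>

text \<open>The J-set property is applied to the translated functions \<open>f (t + r)\<close>, and
  the resulting argument set is moved up by \<open>r\<close>. It supplies the growth condition on
  \<open>H\<close>.\<close>

lemma J_set_beyond:
  assumes "J_set A" "F \<in> Pf PNPN"
  obtains a b where "a \<in> PN" "b \<in> Pf PN" "r < Min b" "\<forall>f\<in>F. a + (\<Sum>t\<in>b. f t) \<in> A"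
proof -
  define shift where "shift f = (\<lambda>t\<in>PN. f (t + r))" for f :: "nat \<Rightarrow> nat"
  have "f (t + r) \<in> PN" if "f \<in> PNPN" "t \<in> PN" for f t
  proof -
    have "t + r \<in> PN" using that(2) by (simp add: PN_def)
    then show ?thesis using that(1) PiE_mem unfolding PNPN_def by metis
  qed
  then have "shift f \<in> PNPN" if "f \<in> PNPN" for f
    using that by (simp add: shift_def PNPN_def restrict_PiE_iff)
  then have "shift ` F \<in> Pf PNPN" using assms(2) by (auto simp: Pf_def Fpow_def)
  with assms(1) obtain a b where a: "a \<in> PN" and b: "b \<in> Pf PN"
    and ab: "\<forall>g\<in>shift ` F. a + (\<Sum>t\<in>b. g t) \<in> A"
    by (rule J_setE)
  have b': "finite b" "b \<noteq> {}" "b \<subseteq> PN" using b by (auto simp: Pf_def Fpow_def)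
  let ?b = "(\<lambda>t. t + r) ` b"
  show thesis
  proof (rule that[of a ?b])
    show "a \<in> PN" by fact
    show "?b \<in> Pf PN" using b' by (auto simp: Pf_def Fpow_def PN_def)
    have "Min ?b \<in> ?b" using b' by (intro Min_in) auto
    then show "r < Min ?b" using b'(3) by (auto simp: PN_def)
    show "\<forall>f\<in>F. a + (\<Sum>t\<in>?b. f t) \<in> A"
    proof
      fix f assume "f \<in> F"
      have "(\<Sum>t\<in>?b. f t) = (\<Sum>t\<in>b. f (t + r))"
        by (subst sum.reindex) (auto simp: inj_on_def)
      also have "\<dots> = (\<Sum>t\<in>b. shift f t)"
        by (rule sum.cong) (use b'(3) in \<open>auto simp: shift_def\<close>)
      finally show "a + (\<Sum>t\<in>?b. f t) \<in> A" using ab \<open>f \<in> F\<close> by auto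
    qed
  qed
qed

definition star :: "nat set set \<Rightarrow> nat set \<Rightarrow> nat set" where
  "star p A = {x \<in> A. {y \<in> PN. x + y \<in> A} \<in> p}"

lemma star_mem:
  assumes p: "p \<in> beta PN" "uf_idempotent p" and A: "A \<in> p"
  shows "star p A \<in> p"
proof -
  have "A \<subseteq> PN" using beta_sub[OF p(1) A] .
  have "A \<in> uf_plus p p" using p(2) A by (simp add: uf_idempotent_def)
  then have "{x \<in> PN. {y \<in> PN. x + y \<in> A} \<in> p} \<in> p" by (simp add: uf_plus_def)
  moreover have "star p A = A \<inter> {x \<in> PN. {y \<in> PN. x + y \<in> A} \<in> p}"
    using \<open>A \<subseteq> PN\<close> by (auto simp: star_def)
  ultimately show ?thesis using beta_Int[OF p(1) A] by simp
qed

text \<open>Translation commutes with starring by associativity, so \<open>star_mem\<close> for the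
  translate \<open>?B\<close> suffices. Hence a partial sum in a starred set can be enlarged without
  leaving it.\<close>

lemma star_translate:
  assumes p: "p \<in> beta PN" "uf_idempotent p" and A: "A \<in> p" and x: "x \<in> star p A"
  shows "{y \<in> PN. x + y \<in> star p A} \<in> p"
proof -
  let ?B = "{y \<in> PN. x + y \<in> A}"
  have "?B \<in> p" using x by (simp add: star_def)
  then have "?B \<inter> star p ?B \<in> p" using star_mem[OF p] beta_Int[OF p(1)] by blast
  moreover have "star p ?B = {y \<in> PN. x + y \<in> star p A}"
  proof -
    have "x \<in> PN" using x beta_sub[OF p(1) A] by (auto simp: star_def)
    then have "{z \<in> PN. y + z \<in> ?B} = {z \<in> PN. x + y + z \<in> A}" for y
      by (auto simp: PN_def add.assoc)
    then show ?thesis by (auto simp: star_def)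
  qed
  ultimately show ?thesis using star_mem[OF p \<open>?B \<in> p\<close>] by simp
qed

text \<open>Here \<open>D k\<close> is the \<open>k\<close>-th iterated section of a member \<open>D m\<close> of the tensor product.\<close>

locale tensor_sections =
  fixes m :: nat and p :: "nat \<Rightarrow> nat set set" and D :: "nat \<Rightarrow> (nat \<Rightarrow> nat) set"
  assumes p: "j \<in> {1..m} \<Longrightarrow> p j \<in> JJ" and idem: "j \<in> {1..m} \<Longrightarrow> uf_idempotent (p j)"
    and D_0: "(\<lambda>_. undefined) \<in> D 0"
    and D_Suc: "k < m \<Longrightarrow> s \<in> D k \<Longrightarrow> {y \<in> PN. s(Suc k := y) \<in> D (Suc k)} \<in> p (Suc k)"
begin

lemma p_beta: "j \<in> {1..m} \<Longrightarrow> p j \<in> beta PN"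
  using p by (auto simp: JJ_def)

text \<open>Entry \<open>k\<close> is overwritten, so the same formula serves a
  \<open>k\<close>-tuple whose last entry is to grow and a shorter tuple about to receive entry
  \<open>k\<close>.\<close>

definition sect :: "nat \<Rightarrow> (nat \<Rightarrow> nat) \<Rightarrow> nat set" where
  "sect k s = {y \<in> PN. s(k := y) \<in> D k}"

text \<open>The invariant of the construction. Membership in \<open>D k\<close> alone would not
  survive adding to the last entry; the starred section does.\<close>

definition good :: "nat \<Rightarrow> (nat \<Rightarrow> nat) \<Rightarrow> bool" where
  "good k s \<longleftrightarrow> s \<in> D k \<and> (0 < k \<longrightarrow> sect k s \<in> p k \<and> s k \<in> star (p k) (sect k s))"

text \<open>The admissible increments at position \<open>j\<close> of a good \<open>k\<close>-tuple \<open>s\<close>: for \<open>j = k\<close> they are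
  added to the last entry, for \<open>j = Suc k\<close> they are appended.\<close>

definition admissible :: "nat \<Rightarrow> nat \<Rightarrow> (nat \<Rightarrow> nat) \<Rightarrow> nat set" where
  "admissible j k s =
    (if k = j then {y \<in> PN. s j + y \<in> star (p j) (sect j s)} else star (p j) (sect j s))"

text \<open>An open last entry lies in a starred set, whose translate is again large; for a fresh
  entry the section is large by \<open>D_Suc\<close>, and starring keeps it so.\<close>

lemma admissible_mem:
  assumes "good k s" "j \<in> {1..m}" "k = j \<or> Suc k = j"
  shows "admissible j k s \<in> p j"
proof (cases "k = j")
  case True
  then show ?thesis
    using assms star_translate[OF p_beta idem] by (simp add: admissible_def good_def)
next
  case False
  then have "k < m" "j = Suc k" using assms by auto
  then have "sect j s \<in> p j" using D_Suc assms(1) by (simp add: good_def sect_def)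
  then show ?thesis using False assms(2) star_mem[OF p_beta idem] by (simp add: admissible_def)
qed

lemma good_upd:
  assumes "sect j s \<in> p j" "y \<in> star (p j) (sect j s)"
  shows "good j (s(j := y))"
proof -
  have "sect j (s(j := y)) = sect j s" by (simp add: sect_def)
  moreover have "y \<in> sect j s" using assms(2) by (simp add: star_def)
  then have "s(j := y) \<in> D j" by (simp add: sect_def)
  ultimately show ?thesis using assms by (simp add: good_def)
qed

text \<open>The assumption speaks only of subsets of \<open>U\<close>, so the lemma applies in the
  middle of the recursion, when weights at larger sets are still unspecified.\<close>

lemma reach_good:
  assumes "reach X w U k s" "k \<le> m"
    and "\<forall>V j f U' k s. V \<in> Pf X \<longrightarrow> V \<subseteq> U \<longrightarrow> f \<in> V \<longrightarrow> reach X w U' k s \<longrightarrow> U' \<subset> V \<longrightarrow>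
      j \<in> {1..m} \<longrightarrow> k = j \<or> Suc k = j \<longrightarrow> w j V f \<in> admissible j k s"
  shows "good k s"
  using assms
proof (induction rule: reach.induct)
  case reach_empty
  show ?case using D_0 by (simp add: good_def)
next
  case (reach_same U k s G f)
  have good: "good k s"
    by (rule reach_same.IH[OF reach_same.prems(1)]) (use reach_same.prems(2) reach_same.hyps(4) in blast)
  have "k \<in> {1..m}" using reach_same by simp
  then have "w k G f \<in> admissible k k s"
    using reach_same.prems(2) reach_same.hyps by blast
  then have "s k + w k G f \<in> star (p k) (sect k s)" by (simp add: admissible_def)
  moreover have "sect k s \<in> p k" using good reach_same.hyps(2) by (simp add: good_def)
  ultimately show ?case by (intro good_upd)
next
  case (reach_next U k s G f)
  have good: "good k s"
    by (rule reach_next.IH) (use reach_next.prems reach_next.hyps(3) in auto)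
  have j: "Suc k \<in> {1..m}" using reach_next by simp
  then have "w (Suc k) G f \<in> admissible (Suc k) k s"
    using reach_next.prems(2) reach_next.hyps by blast
  then have "w (Suc k) G f \<in> star (p (Suc k)) (sect (Suc k) s)" by (simp add: admissible_def)
  moreover have "sect (Suc k) s \<in> p (Suc k)"
    using good D_Suc j by (simp add: good_def sect_def)
  ultimately show ?case by (intro good_upd)
qed

section \<open>The recursive choice of weights\<close>

abbreviation weights :: "((nat \<Rightarrow> nat) set \<Rightarrow> nat \<Rightarrow> nat \<times> nat set) \<Rightarrow>
    nat \<Rightarrow> (nat \<Rightarrow> nat) set \<Rightarrow> (nat \<Rightarrow> nat) \<Rightarrow> nat" where
  "weights c j \<equiv> weight (\<lambda>G. fst (c G j)) (\<lambda>G. snd (c G j))"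

text \<open>A pair \<open>v\<close> stands for the values of \<alpha> and \<open>H\<close> in
  coordinate \<open>j\<close> at \<open>F\<close>. All demands refer to \<open>c\<close> at proper
  subsets of \<open>F\<close> only, as the recursion requires.\<close>

definition extends :: "((nat \<Rightarrow> nat) set \<Rightarrow> nat \<Rightarrow> nat \<times> nat set) \<Rightarrow> (nat \<Rightarrow> nat) set \<Rightarrow>
    nat \<Rightarrow> nat \<times> nat set \<Rightarrow> bool" where
  "extends c F j v \<longleftrightarrow> fst v \<in> PN \<and> snd v \<in> Pf PN \<and>
    (\<forall>V\<in>Pf PNPN. V \<subset> F \<longrightarrow> Max (snd (c V j)) < Min (snd v)) \<and>
    (\<forall>f\<in>F. \<forall>U k s. reach PNPN (weights c) U k s \<longrightarrow> U \<subset> F \<longrightarrow> k = j \<or> Suc k = j \<longrightarrow>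
      fst v + (\<Sum>t\<in>snd v. f t) \<in> admissible j k s)"

lemma good_below:
  assumes "\<And>V j. V \<in> Pf PNPN \<Longrightarrow> V \<subseteq> U \<Longrightarrow> j \<in> {1..m} \<Longrightarrow> extends c V j (c V j)"
    and "reach PNPN (weights c) U k s" "k \<le> m"
  shows "good k s"
proof (rule reach_good[OF assms(2,3)], intro allI impI)
  fix V j f U' k s
  assume *: "V \<in> Pf PNPN" "V \<subseteq> U" "f \<in> V" "reach PNPN (weights c) U' k s" "U' \<subset> V"
    "j \<in> {1..m}" "k = j \<or> Suc k = j"
  have "extends c V j (c V j)" by (rule assms(1)) (use * in auto)
  then show "weights c j V f \<in> admissible j k s"
    using * unfolding extends_def weight_def by blast
qed

text \<open>Finitely many states lie below \<open>F\<close>, so their admissible sets have an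
  intersection \<open>E\<close> in \<open>p j\<close>. As \<open>E\<close> is a J-set, one pair
  works for all functions in \<open>F\<close>.\<close>

lemma extension_exists:
  assumes F: "F \<in> Pf PNPN" and j: "j \<in> {1..m}"
    and below: "\<And>V j. V \<in> Pf PNPN \<Longrightarrow> V \<subset> F \<Longrightarrow> j \<in> {1..m} \<Longrightarrow> extends c V j (c V j)"
  shows "\<exists>v. extends c F j v"
proof -
  have "finite F" using F by (simp add: Pf_def Fpow_def)
  let ?states = "{(k, s). \<exists>U. U \<subset> F \<and> reach PNPN (weights c) U k s}"
  let ?S = "{(k, s) \<in> ?states. k = j \<or> Suc k = j}"
  define E where "E = {y \<in> PN. \<forall>x\<in>?S. y \<in> admissible j (fst x) (snd x)}"
  have "E \<in> p j"
    unfolding E_def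
  proof (rule beta_finite_INT[OF p_beta[OF j]])
    show "finite ?S" by (rule finite_subset[OF _ finite_reach_below[OF \<open>finite F\<close>]]) blast
    fix x assume "x \<in> ?S"
    then obtain k s U where x: "x = (k, s)" "k = j \<or> Suc k = j" "U \<subset> F"
      "reach PNPN (weights c) U k s" by blast
    have "k \<le> m" using x(2) j by auto
    have "good k s"
      by (rule good_below[OF _ x(4) \<open>k \<le> m\<close>]) (rule below, use x(3) in auto)
    from admissible_mem[OF this j x(2)] show "admissible j (fst x) (snd x) \<in> p j" by (simp add: x(1))
  qed
  then have "J_set E" using p[OF j] by (simp add: JJ_def)
  \<comment> \<open>Any common bound for the earlier maxima will do; the sum over all subsets of
    \<open>F\<close> is one.\<close>
  define r where "r = (\<Sum>V\<in>Pow F. Max (snd (c V j)))"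
  have r: "Max (snd (c V j)) \<le> r" if "V \<subset> F" for V
    unfolding r_def using that \<open>finite F\<close> by (intro member_le_sum) auto
  from J_set_beyond[OF \<open>J_set E\<close> F, of r] obtain a b where
    ab: "a \<in> PN" "b \<in> Pf PN" "r < Min b" "\<forall>f\<in>F. a + (\<Sum>t\<in>b. f t) \<in> E" .
  have "extends c F j (a, b)"
    unfolding extends_def fst_conv snd_conv
  proof (intro conjI ballI allI impI)
    show "Max (snd (c V j)) < Min b" if "V \<subset> F" for V using r[OF that] ab(3) by simp
    fix f U k s assume *: "f \<in> F" "reach PNPN (weights c) U k s" "U \<subset> F" "k = j \<or> Suc k = j"
    then have "(k, s) \<in> ?S" by blast
    moreover have "a + (\<Sum>t\<in>b. f t) \<in> E" using ab(4) *(1) by blast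
    ultimately show "a + (\<Sum>t\<in>b. f t) \<in> admissible j k s" by (auto simp: E_def)
  qed (use ab in auto)
  then show ?thesis by blast
qed

lemma extends_cong:
  assumes "\<And>V. V \<subset> F \<Longrightarrow> c V = c' V" "extends c F j v"
  shows "extends c' F j v"
proof -
  have reach: "reach PNPN (weights c) U k s" if "reach PNPN (weights c') U k s" "U \<subset> F" for U k s
    by (rule reach_cong[OF that(1)]) (use assms(1) that(2) in \<open>auto simp: weight_def\<close>)
  then show ?thesis using assms unfolding extends_def by (metis (no_types, lifting))
qed

lemma extending_choice_exists: "\<exists>c. \<forall>F\<in>Pf PNPN. \<forall>j\<in>{1..m}. extends c F j (c F j)"
proof -
  \<comment> \<open>All coordinates are chosen together at each \<open>F\<close>, because a tuple
    reached below \<open>F\<close> may mix weights of different coordinates.\<close>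
  let ?P = "\<lambda>c F v. F \<in> Pf PNPN \<longrightarrow> (\<forall>j\<in>{1..m}. extends c F j (v j))"
  have "\<exists>c. \<forall>F. ?P c F (c F)"
  proof (rule dependent_wf_choice[OF wf_finite_psubset])
    fix c c' :: "(nat \<Rightarrow> nat) set \<Rightarrow> nat \<Rightarrow> nat \<times> nat set" and F v
    assume eq: "\<And>V. (V, F) \<in> finite_psubset \<Longrightarrow> c V = c' V"
    show "?P c F v = ?P c' F v"
    proof (cases "F \<in> Pf PNPN")
      case True
      then have "c V = c' V" if "V \<subset> F" for V
        using eq that by (auto simp: finite_psubset_def Pf_def Fpow_def)
      then have "extends c F j x \<longleftrightarrow> extends c' F j x" for j x
        using extends_cong[of F c c' j x] extends_cong[of F c' c j x] by auto
      then show ?thesis by simp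
    qed simp
  next
    fix F and c :: "(nat \<Rightarrow> nat) set \<Rightarrow> nat \<Rightarrow> nat \<times> nat set"
    assume IH: "\<And>V. (V, F) \<in> finite_psubset \<Longrightarrow> ?P c V (c V)"
    show "\<exists>v. ?P c F v"
    proof (cases "F \<in> Pf PNPN")
      case True
      then have "finite F" by (simp add: Pf_def Fpow_def)
      have "\<exists>v. extends c F j v" if "j \<in> {1..m}" for j
        by (rule extension_exists[OF True that])
          (use IH \<open>finite F\<close> in \<open>auto simp: finite_psubset_def\<close>)
      then show ?thesis using bchoice[of "{1..m}" "\<lambda>j v. extends c F j v"] by blast
    qed simp
  qed
  then show ?thesis by blast
qed

end

section \<open>The equivalence\<close>

text \<open>Condition (1) concerns infinite sequences, while a derivation provides only a finite
  chain; the chain is prolonged arbitrarily beyond the last index used by the tuple.\<close>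

lemma reach_infinite_sequence:
  assumes "infinite X" "reach X w U m s" "s \<in> extensional {1..m}"
  obtains G f \<beta> where "\<forall>i\<in>PN. G i \<in> Pf X" "\<forall>i\<in>PN. G i \<subset> G (i + 1)" "\<forall>i\<in>PN. f i \<in> G i"
    "\<forall>j\<in>{1..m}. \<beta> j \<in> Pf PN" "\<forall>j\<in>{1..<m}. Max (\<beta> j) < Min (\<beta> (j + 1))"
    "s = (\<lambda>j\<in>{1..m}. \<Sum>i\<in>\<beta> j. w j (G i) (f i))"
proof -
  from reach_sequence[OF assms(2)] obtain n G f \<beta> where IH0:
    "\<forall>i\<in>{1..n}. G i \<in> Pf X \<and> f i \<in> G i" "\<forall>i\<in>{1..<n}. G i \<subset> G (Suc i)"
    "U = (if n = 0 then {} else G n)"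
    "\<forall>j\<in>{1..m}. \<beta> j \<subseteq> {1..n} \<and> \<beta> j \<noteq> {} \<and> s j = (\<Sum>i\<in>\<beta> j. w j (G i) (f i))"
    "\<forall>j\<in>{1..<m}. \<forall>a\<in>\<beta> j. \<forall>b\<in>\<beta> (Suc j). a < b"
    by (elim exE conjE) (rule that)
  note IH = IH0[rule_format]
  obtain E where E: "\<And>i. E i \<in> Pf X" "U \<subset> E 0" "\<And>i. E i \<subset> E (Suc i)"
    by (rule strict_chain_exists[OF assms(1) reach_top[OF assms(2)]]) (rule that)
  \<comment> \<open>The shift by \<open>Suc n\<close> places \<open>E 0\<close>, which lies strictly
    above \<open>U\<close>, directly after the finite chain.\<close>
  define G1 where "G1 i = (if i \<le> n then G i else E (i - Suc n))" for i
  define f1 where "f1 i = (if i \<le> n then f i else SOME x. x \<in> G1 i)" for i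
  have 1: "G1 i \<in> Pf X" if "i \<in> PN" for i
    using IH(1)[of i] E(1) that by (simp add: G1_def PN_def)
  have \<beta>: "finite (\<beta> j)" "\<beta> j \<noteq> {}" "\<beta> j \<subseteq> PN" "\<beta> j \<subseteq> {..n}" if "j \<in> {1..m}" for j
    using IH(4)[OF that] finite_subset by (auto simp: PN_def)
  show thesis
  proof (rule that[of G1 f1 \<beta>])
    show "\<forall>i\<in>PN. G1 i \<in> Pf X" using 1 by blast
    show "\<forall>i\<in>PN. f1 i \<in> G1 i"
    proof
      fix i assume i: "i \<in> PN"
      show "f1 i \<in> G1 i"
      proof (cases "i \<le> n")
        case True
        then show ?thesis using IH(1)[of i] i by (simp add: G1_def f1_def PN_def)
      next
        case False
        then show ?thesis using some_in_eq[of "G1 i"] 1[OF i] by (simp add: f1_def Pf_def)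
      qed
    qed
    show "\<forall>i\<in>PN. G1 i \<subset> G1 (i + 1)"
    proof
      fix i assume i: "i \<in> PN"
      consider "i < n" | "i = n" | "n < i" by linarith
      then show "G1 i \<subset> G1 (i + 1)"
      proof cases
        case 1
        then show ?thesis using IH(2)[of i] i by (simp add: G1_def PN_def)
      next
        case 2
        then show ?thesis using IH(3) E(2) i by (simp add: G1_def PN_def)
      next
        case 3
        then show ?thesis using E(3)[of "i - Suc n"] by (simp add: G1_def Suc_diff_Suc)
      qed
    qed
    show "\<forall>j\<in>{1..m}. \<beta> j \<in> Pf PN" using \<beta> by (auto simp: Pf_def Fpow_def)
    show "\<forall>j\<in>{1..<m}. Max (\<beta> j) < Min (\<beta> (j + 1))"
    proof
      fix j assume j: "j \<in> {1..<m}"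
      then have "j \<in> {1..m}" "j + 1 \<in> {1..m}" by auto
      then have "Max (\<beta> j) \<in> \<beta> j" "Min (\<beta> (j + 1)) \<in> \<beta> (Suc j)"
        using \<beta>(1,2) Max_in[of "\<beta> j"] Min_in[of "\<beta> (j + 1)"] by simp_all
      then show "Max (\<beta> j) < Min (\<beta> (j + 1))" using IH(5)[OF j] by blast
    qed
    show "s = (\<lambda>j\<in>{1..m}. \<Sum>i\<in>\<beta> j. w j (G1 i) (f1 i))"
    proof (rule extensionalityI[OF assms(3) restrict_extensional])
      fix j assume j: "j \<in> {1..m}"
      have "(\<Sum>i\<in>\<beta> j. w j (G i) (f i)) = (\<Sum>i\<in>\<beta> j. w j (G1 i) (f1 i))"
        by (rule sum.cong) (use \<beta>(4)[OF j] in \<open>auto simp: G1_def f1_def\<close>)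
      then show "s j = (\<lambda>j\<in>{1..m}. \<Sum>i\<in>\<beta> j. w j (G1 i) (f1 i)) j" using IH(4)[OF j] j by simp
    qed
  qed
qed

theorem corollary1p33:
  fixes m :: nat and h :: "(nat \<Rightarrow> nat) \<Rightarrow> nat" and A :: "nat set"
  assumes "m \<in> PN"
    and "poly_no_const m h"
    and "A \<subseteq> PN"
  shows
    "(\<exists>(\<alpha> :: nat \<Rightarrow> (nat \<Rightarrow> nat) set \<Rightarrow> nat) (H :: nat \<Rightarrow> (nat \<Rightarrow> nat) set \<Rightarrow> nat set).
        (\<forall>j\<in>{1..m}. \<alpha> j \<in> Pf PNPN \<rightarrow> PN) \<and>
        (\<forall>j\<in>{1..m}. H j \<in> Pf PNPN \<rightarrow> Pf PN) \<and>
        (\<forall>F \<in> Pf PNPN. \<forall>G \<in> Pf PNPN. F \<subset> G \<longrightarrow>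
           (\<forall>j\<in>{1..m}. Max (H j F) < Min (H j G))) \<and>
        (\<forall>G :: nat \<Rightarrow> (nat \<Rightarrow> nat) set.
           (\<forall>i\<in>PN. G i \<in> Pf PNPN) \<and> (\<forall>i\<in>PN. G i \<subset> G (i + 1)) \<longrightarrow>
           (\<forall>(\<beta> :: nat \<Rightarrow> nat set) (f :: nat \<Rightarrow> nat \<Rightarrow> nat).
              (\<forall>j\<in>{1..m}. \<beta> j \<in> Pf PN) \<and>
              (\<forall>j\<in>{1..<m}. Max (\<beta> j) < Min (\<beta> (j + 1))) \<and>
              (\<forall>i\<in>PN. f i \<in> G i) \<longrightarrow>
              h (\<lambda>j\<in>{1..m}. \<Sum>i\<in>\<beta> j. (\<alpha> j (G i) + (\<Sum>t\<in>H j (G i). f i t))) \<in> A)))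
     \<longleftrightarrow>
     (\<exists>p :: nat \<Rightarrow> nat set set.
        (\<forall>j\<in>{1..m}. p j \<in> JJ \<and> uf_idempotent (p j)) \<and>
        A \<in> uf_ext m h (tensor p m))"
    (is "?lhs \<longleftrightarrow> ?rhs")
proof
  assume ?lhs
  then obtain \<alpha> H where
    \<alpha>: "\<forall>j\<in>{1..m}. \<alpha> j \<in> Pf PNPN \<rightarrow> PN" and H: "\<forall>j\<in>{1..m}. H j \<in> Pf PNPN \<rightarrow> Pf PN"
    and inc: "\<forall>F \<in> Pf PNPN. \<forall>G \<in> Pf PNPN. F \<subset> G \<longrightarrow>
           (\<forall>j\<in>{1..m}. Max (H j F) < Min (H j G))"
    and val: "\<forall>G :: nat \<Rightarrow> (nat \<Rightarrow> nat) set.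
           (\<forall>i\<in>PN. G i \<in> Pf PNPN) \<and> (\<forall>i\<in>PN. G i \<subset> G (i + 1)) \<longrightarrow>
           (\<forall>(\<beta> :: nat \<Rightarrow> nat set) (f :: nat \<Rightarrow> nat \<Rightarrow> nat).
              (\<forall>j\<in>{1..m}. \<beta> j \<in> Pf PN) \<and>
              (\<forall>j\<in>{1..<m}. Max (\<beta> j) < Min (\<beta> (j + 1))) \<and>
              (\<forall>i\<in>PN. f i \<in> G i) \<longrightarrow>
              h (\<lambda>j\<in>{1..m}. \<Sum>i\<in>\<beta> j. (\<alpha> j (G i) + (\<Sum>t\<in>H j (G i). f i t))) \<in> A)"
    by (elim exE conjE) (rule that)
  define w where "w j = weight (\<alpha> j) (H j)" for j
  \<comment> \<open>The idempotents are found coordinate by coordinate: the coordinates interact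
    only through the set above which the next block must start, and each idempotent contains the
    sums above every such set.\<close>
  have "\<forall>j\<in>{1..m}. \<exists>q. q \<in> JJ \<and> uf_idempotent q \<and> (\<forall>F\<in>Fpow PNPN. chain_sums PNPN (w j) F \<in> q)"
  proof
    fix j assume j: "j \<in> {1..m}"
    have "\<exists>q\<in>JJ. uf_idempotent q \<and> (\<forall>F\<in>Fpow PNPN. chain_sums PNPN (w j) F \<in> q)"
      unfolding w_def
      by (rule chain_sums_idempotent) (use \<alpha> H inc j in \<open>auto simp del: One_nat_def\<close>)
    then show "\<exists>q. q \<in> JJ \<and> uf_idempotent q \<and> (\<forall>F\<in>Fpow PNPN. chain_sums PNPN (w j) F \<in> q)" by blast
  qed
  then obtain p where p: "\<And>j. j \<in> {1..m} \<Longrightarrow> p j \<in> JJ" "\<And>j. j \<in> {1..m} \<Longrightarrow> uf_idempotent (p j)"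
    "\<And>j F. j \<in> {1..m} \<Longrightarrow> F \<in> Fpow PNPN \<Longrightarrow> chain_sums PNPN (w j) F \<in> p j"
    by metis
  obtain k where k: "m = Suc k" using assms(1) by (cases m) (auto simp: PN_def)
  have pb: "p j \<in> beta PN" if "j \<in> {1..m}" for j using p(1)[OF that] by (simp add: JJ_def)
  have "w j G f \<in> PN" if "j \<in> {1..m}" "G \<in> Pf PNPN" for j G f
  proof -
    have "\<alpha> j G \<in> PN" using \<alpha> that by blast
    then show ?thesis by (simp add: w_def weight_def PN_def)
  qed
  then have "{s \<in> PNpow m. \<exists>U. reach PNPN w U m s} \<in> tensor p m"
    unfolding k by (intro reach_tensor[where m = m]) (use pb p(3) k in auto)
  \<comment> \<open>Prolonging the underlying chain to an infinite sequence leaves the tuple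
    unchanged, so (1) can be applied to it.\<close>
  moreover have "{s \<in> PNpow m. \<exists>U. reach PNPN w U m s} \<subseteq> {s \<in> PNpow m. h s \<in> A}"
  proof clarify
    fix s U assume s: "s \<in> PNpow m" and U: "reach PNPN w U m s"
    have "s \<in> extensional {1..m}" using s by (auto simp: PNpow_def PiE_def)
    from reach_infinite_sequence[OF infinite_PNPN U this] obtain G f \<beta> where
      *: "\<forall>i\<in>PN. G i \<in> Pf PNPN" "\<forall>i\<in>PN. G i \<subset> G (i + 1)" "\<forall>i\<in>PN. f i \<in> G i"
      "\<forall>j\<in>{1..m}. \<beta> j \<in> Pf PN" "\<forall>j\<in>{1..<m}. Max (\<beta> j) < Min (\<beta> (j + 1))"
      "s = (\<lambda>j\<in>{1..m}. \<Sum>i\<in>\<beta> j. w j (G i) (f i))" .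
    have "h (\<lambda>j\<in>{1..m}. \<Sum>i\<in>\<beta> j. (\<alpha> j (G i) + (\<Sum>t\<in>H j (G i). f i t))) \<in> A"
      by (rule val[THEN spec, THEN mp, THEN spec, THEN spec, THEN mp]) (intro conjI *)+
    then show "h s \<in> A" unfolding *(6) w_def weight_def .
  qed
  ultimately have "{s \<in> PNpow m. h s \<in> A} \<in> tensor p m"
    unfolding k by (rule tensor_mono[rotated]) (use pb k in auto)
  then have "A \<in> uf_ext m h (tensor p m)" using assms(3) by (simp add: uf_ext_def)
  then show ?rhs using p by blast
next
  assume ?rhs
  then obtain p where p: "\<And>j. j \<in> {1..m} \<Longrightarrow> p j \<in> JJ" "\<And>j. j \<in> {1..m} \<Longrightarrow> uf_idempotent (p j)"
    and "A \<in> uf_ext m h (tensor p m)" by blast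
  then have B: "{s \<in> PNpow m. h s \<in> A} \<in> tensor p m" by (simp add: uf_ext_def)
  obtain k where k: "m = Suc k" using assms(1) by (cases m) (auto simp: PN_def)
  from tensor_sections[OF B[unfolded k]] obtain D where D: "D m = {s \<in> PNpow m. h s \<in> A}"
    "(\<lambda>_. undefined) \<in> D 0"
    "\<forall>i\<le>k. \<forall>x\<in>D i. {y \<in> PN. x(Suc i := y) \<in> D (Suc i)} \<in> p (Suc i)"
    unfolding k by blast
  interpret tensor_sections m p D
    by unfold_locales (use p D k in \<open>auto simp del: One_nat_def\<close>)
  obtain c where c: "\<And>F j. F \<in> Pf PNPN \<Longrightarrow> j \<in> {1..m} \<Longrightarrow> extends c F j (c F j)"
    using extending_choice_exists by blast
  show ?lhs
  proof (intro exI conjI ballI allI impI)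
    show "(\<lambda>F. fst (c F j)) \<in> Pf PNPN \<rightarrow> PN" if "j \<in> {1..m}" for j
      using c[OF _ that] by (auto simp: extends_def)
    show "(\<lambda>F. snd (c F j)) \<in> Pf PNPN \<rightarrow> Pf PN" if "j \<in> {1..m}" for j
      using c[OF _ that] by (auto simp: extends_def)
    show "Max (snd (c F j)) < Min (snd (c G j))"
      if "F \<in> Pf PNPN" "G \<in> Pf PNPN" "F \<subset> G" "j \<in> {1..m}" for F G j
      using c[OF that(2,4)] that(1,3) by (simp add: extends_def)
    fix G :: "nat \<Rightarrow> (nat \<Rightarrow> nat) set" and \<beta> :: "nat \<Rightarrow> nat set" and f :: "nat \<Rightarrow> nat \<Rightarrow> nat"
    assume G: "(\<forall>i\<in>PN. G i \<in> Pf PNPN) \<and> (\<forall>i\<in>PN. G i \<subset> G (i + 1))"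
      and \<beta>: "(\<forall>j\<in>{1..m}. \<beta> j \<in> Pf PN) \<and> (\<forall>j\<in>{1..<m}. Max (\<beta> j) < Min (\<beta> (j + 1))) \<and>
        (\<forall>i\<in>PN. f i \<in> G i)"
    let ?s = "\<lambda>j\<in>{1..m}. \<Sum>i\<in>\<beta> j. weights c j (G i) (f i)"
    have "reach PNPN (weights c) (if m = 0 then {} else G (Max (\<beta> m))) m ?s"
      by (rule sequence_reach[where m = m]) (use G \<beta> in blast)+
    \<comment> \<open>The value condition in (1) is the invariant at full length: a good
      \<open>m\<close>-tuple lies in \<open>D m\<close>, which was chosen as the preimage of
      \<open>A\<close> under \<open>h\<close>.\<close>
    then have "good m ?s" using c by (intro good_below[where k = m]) auto
    then have "?s \<in> D m" by (simp add: good_def)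
    then show "h (\<lambda>j\<in>{1..m}. \<Sum>i\<in>\<beta> j. (fst (c (G i) j) + (\<Sum>t\<in>snd (c (G i) j). f i t))) \<in> A"
      unfolding D(1) weight_def by blast
  qed
qed

end
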